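(* Let $N\ge 2$, let $\widetilde{\mathsf A}=\{1,2,\dots,N\}$ be linearly ordered in the usual way, and let $\mathsf w$ be a primitive $\widetilde{\mathsf A}$-crown. Then $\mathsf w$ is weakly perfectly clustering if and only if the band module $B(\widetilde\varphi(\mathsf w),1,\lambda)$ over $\Lambda_N$ is a brick for some (equivalently, for any) $\lambda\in\mathcal K^\times$.
   Context: $\mathcal K$ is an algebraically closed field. Paths are composed right to left ($\alpha\beta$ means first $\beta$, then $\alpha$). The algebra $\Lambda_N$. It is $\mathcal KQ/\langle\rho\rangle$ where $Q$ has vertices $v_1,\dots,v_N$ and, for each $1\le i\le N-1$, two arrows $a_i,b_i:v_{i+1}\to v_i$; and $\rho=\{a_ib_{i+1},\,b_ia_{i+1}: 1\le i\le N-2\}$. Modules are finite-dimensional left modules, i.e. representations of $Q$ satisfying the relations. A brick is a module whose endomorphism algebra is isomorphic to $\mathcal K$. Words. Words are finite sequences of letters read from left to right. A word is primitive if it is not a $k$-fold concatenation of a word with itself for any $k\ge2$. A word $n_1\cdots n_k$ is a zigzag if consecutive letters strictly alternate: either $n_1<n_2>n_3<\cdots$ or $n_1>n_2<n_3>\cdots$. A crown is a zigzag all of whose cyclic permutations are zigzags (crowns have even length $\ge 2$). Weakly perfectly clustering. A primitive crown $\mathsf w$ is weakly perfectly clustering if neither of the following happens. (1) There exist cyclic permutations $\mathsf w'=n'\mathsf z m'\mathsf z'$ and $\mathsf w''=n''\mathsf z m''\mathsf z''$ of $\mathsf w$, where $n',m',n'',m''$ are letters and $\mathsf z,\mathsf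 z',\mathsf z''$ are words, with $n'<n''$, $m'<m''$ and $|\mathsf z|\ge1$. (2) There exist cyclic permutations $\mathsf w'=n'm'\mathsf z'$ and $\mathsf w''=n''m''\mathsf z''$ of $\mathsf w$, where $n',m',n'',m''$ are letters and $\mathsf z',\mathsf z''$ are words, with $n'<n''$, $m'<m''$, ($n'<m'$ if and only if $n''<m''$), and $[n',m']\cap[n'',m'']\ne\emptyset$. Here $[n,m]$ denotes the set of all letters lying between $n$ and $m$ inclusive (whichever of $n,m$ is larger). The map $\widetilde\varphi$. For letters $i<j$, let $\mathfrak x_{i,j}:=b_{j-1}^{-1}\cdots b_{i+1}^{-1}b_i^{-1}$ (a walk from $v_i$ to $v_j$, read right to left) and $\mathfrak x_{j,i}:=a_i\cdots a_{j-2}a_{j-1}$ (a walk from $v_j$ to $v_i$). For a crown $\mathsf w=n_1\cdots n_k$, set $\widetilde\varphi(\mathsf w):=\mathfrak x_{n_k,n_1}\mathfrak x_{n_{k-1},n_k}\cdots\mathfrak x_{n_1,n_2}$. If $\mathsf w$ is primitive, this is (a cyclic permutation of) a band of $\Lambda_N$. Band modules. For a cyclic permutation $\mathfrak b=\alpha_k\cdots\alpha_1$ of a band, with each $\alpha_j$ an arrow or a formal inverse of an arrow, let $u_0$ be the start of $\alpha_1$ and $u_j$ the end of $\alpha_j$ (so $u_k=u_0$), with indices of $V_j$ below taken modulo $k$. For $l\ge1$ and $\lambda\in\mathcal K^\times$, $B(\mathfrak b,l,\lambda)$ is the usual band module: one places a copy $V_j$ of $\mathcal K^l$ at vertex $u_j$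 for each $j\in\mathbb Z/k$; if $\alpha_j$ is an arrow it maps $V_{j-1}\to V_j$; if $\alpha_j=\beta^{-1}$ then $\beta$ maps $V_j\to V_{j-1}$; one of these maps is the $l\times l$ Jordan block with eigenvalue $\lambda$, the others are identity maps, and all other components of arrows are zero. *)

theory Defs
  imports
    "HOL-Library.FuncSet"
    "HOL-Computational_Algebra.Polynomial"
    "Graph_Theory.Digraph"
    "Jordan_Normal_Form.Jordan_Normal_Form"
begin

definition cyclic_permutation :: "'a list \<Rightarrow> 'a list \<Rightarrow> bool" where
  "cyclic_permutation w' w \<longleftrightarrow> (\<exists>m. w' = rotate m w)"

definition primitive_word :: "'a list \<Rightarrow> bool" where
  "primitive_word w \<longleftrightarrow> \<not> (\<exists>v k. k \<ge> 2 \<and> w = concat (replicate k v))"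

definition zigzag :: "nat list \<Rightarrow> bool" where
  "zigzag w \<longleftrightarrow>
     (\<forall>i. Suc i < length w \<longrightarrow>
        (if even i then w ! i < w ! Suc i else w ! i > w ! Suc i)) \<or>
     (\<forall>i. Suc i < length w \<longrightarrow>
        (if even i then w ! i > w ! Suc i else w ! i < w ! Suc i))"

text \<open>
  The length condition only excludes words with at most one letter, which are vacuously zigzags.
  That the length is even then follows from the condition on the cyclic permutations.
\<close>
definition crown :: "nat set \<Rightarrow> nat list \<Rightarrow> bool" where
  "crown A w \<longleftrightarrow> set w \<subseteq> A \<and> length w \<ge> 2 \<and>
     (\<forall>w'. cyclic_permutation w' w \<longrightarrow> zigzag w')"

text \<open>
  The alphabets of interest are intervals of natural numbers, so that every number
  lying between two letters is again a letter.
\<close>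
definition letters_between :: "nat \<Rightarrow> nat \<Rightarrow> nat set" where
  "letters_between n m = {min n m..max n m}"

definition weakly_perfectly_clustering :: "nat list \<Rightarrow> bool" where
  "weakly_perfectly_clustering w \<longleftrightarrow>
     \<not> (\<exists>n' m' n'' m'' z z' z''.
          cyclic_permutation ([n'] @ z @ [m'] @ z') w \<and>
          cyclic_permutation ([n''] @ z @ [m''] @ z'') w \<and>
          n' < n'' \<and> m' < m'' \<and> length z \<ge> 1) \<and>
     \<not> (\<exists>n' m' n'' m'' z' z''.
          cyclic_permutation ([n', m'] @ z') w \<and>
          cyclic_permutation ([n'', m''] @ z'') w \<and>
          n' < n'' \<and> m' < m'' \<and> (n' < m' \<longleftrightarrow> n'' < m'') \<and>
          letters_between n' m' \<inter> letters_between n'' m'' \<noteq> {})"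

text \<open>
  A quiver is a directed multigraph. In a relation \<open>(\<alpha>, \<beta>)\<close>, standing for the path
  \<open>\<alpha>\<beta>\<close>, the arrow \<open>\<beta>\<close> comes first; matrices act on column vectors. The values of
  \<open>rep_dim\<close> and \<open>rep_map\<close> outside the quiver are irrelevant.
\<close>
record ('v, 'e, 'k) quiver_rep =
  rep_dim :: "'v \<Rightarrow> nat"
  rep_map :: "'e \<Rightarrow> 'k mat"

definition is_module ::
  "('v, 'e) pre_digraph \<Rightarrow> ('e \<times> 'e) set \<Rightarrow> ('v, 'e, 'k :: field) quiver_rep \<Rightarrow> bool" where
  "is_module Q \<rho> M \<longleftrightarrow>
     (\<forall>e \<in> arcs Q. rep_map M e \<in> carrier_mat (rep_dim M (head Q e)) (rep_dim M (tail Q e))) \<and>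
     (\<forall>(\<alpha>, \<beta>) \<in> \<rho>. rep_map M \<alpha> * rep_map M \<beta> =
        0\<^sub>m (rep_dim M (head Q \<alpha>)) (rep_dim M (tail Q \<beta>)))"

definition endomorphisms ::
  "('v, 'e) pre_digraph \<Rightarrow> ('v, 'e, 'k :: field) quiver_rep \<Rightarrow> ('v \<Rightarrow> 'k mat) set" where
  "endomorphisms Q M =
     {f \<in> (\<Pi>\<^sub>E v \<in> verts Q. carrier_mat (rep_dim M v) (rep_dim M v)).
        \<forall>e \<in> arcs Q. f (head Q e) * rep_map M e = rep_map M e * f (tail Q e)}"

text \<open>The last two conditions require an isomorphism of \<open>\<K>\<close>-algebras (not just of rings).\<close>
definition brick ::
  "('v, 'e) pre_digraph \<Rightarrow> ('e \<times> 'e) set \<Rightarrow> ('v, 'e, 'k :: field) quiver_rep \<Rightarrow> bool" where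
  "brick Q \<rho> M \<longleftrightarrow> is_module Q \<rho> M \<and>
     (\<exists>\<phi> :: 'k \<Rightarrow> 'v \<Rightarrow> 'k mat.
        bij_betw \<phi> UNIV (endomorphisms Q M) \<and>
        (\<forall>x y. \<phi> (x + y) = (\<lambda>v \<in> verts Q. \<phi> x v + \<phi> y v)) \<and>
        (\<forall>x y. \<phi> (x * y) = (\<lambda>v \<in> verts Q. \<phi> x v * \<phi> y v)) \<and>
        \<phi> 1 = (\<lambda>v \<in> verts Q. 1\<^sub>m (rep_dim M v)) \<and>
        (\<forall>c x. \<phi> (c * x) = (\<lambda>v \<in> verts Q. c \<cdot>\<^sub>m \<phi> x v)))"

datatype 'e syllable = Direct 'e | Inverse 'e

fun syllable_start :: "('v, 'e) pre_digraph \<Rightarrow> 'e syllable \<Rightarrow> 'v" where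
  "syllable_start Q (Direct e) = tail Q e"
| "syllable_start Q (Inverse e) = head Q e"

fun syllable_end :: "('v, 'e) pre_digraph \<Rightarrow> 'e syllable \<Rightarrow> 'v" where
  "syllable_end Q (Direct e) = head Q e"
| "syllable_end Q (Inverse e) = tail Q e"

text \<open>
  A walk \<open>\<alpha>\<^sub>k \<dots> \<alpha>\<^sub>1\<close> is the list \<open>[\<alpha>\<^sub>k, \<dots>, \<alpha>\<^sub>1]\<close>, although \<open>\<alpha>\<^sub>1\<close> is traversed first;
  hence \<open>rev \<bb> ! j\<close> is \<open>\<alpha>\<close> with index \<open>j + 1\<close>, which leads from \<open>u\<^sub>j\<close> to \<open>u\<close> with
  index \<open>j + 1\<close> modulo \<open>k\<close>.
\<close>
definition walk_vertex :: "('v, 'e) pre_digraph \<Rightarrow> 'e syllable list \<Rightarrow> nat \<Rightarrow> 'v" where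
  "walk_vertex Q \<bb> j =
     (if j = 0 then syllable_start Q (rev \<bb> ! 0) else syllable_end Q (rev \<bb> ! (j - 1)))"

definition positions_at :: "('v, 'e) pre_digraph \<Rightarrow> 'e syllable list \<Rightarrow> 'v \<Rightarrow> nat list" where
  "positions_at Q \<bb> v = filter (\<lambda>j. walk_vertex Q \<bb> j = v) [0..<length \<bb>]"

text \<open>The component \<open>V\<^sub>s \<rightarrow> V\<^sub>t\<close> of the map attached to the arrow \<open>e\<close>.\<close>
definition band_block ::
  "'e syllable list \<Rightarrow> nat \<Rightarrow> nat \<Rightarrow> 'k :: field \<Rightarrow> 'e \<Rightarrow> nat \<Rightarrow> nat \<Rightarrow> 'k mat" where
  "band_block \<bb> p l lam e t s = mat l l (\<lambda>(r, c).
     \<Sum>j < length \<bb>.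
       if (rev \<bb> ! j = Direct e \<and> s = j \<and> t = Suc j mod length \<bb>) \<or>
          (rev \<bb> ! j = Inverse e \<and> s = Suc j mod length \<bb> \<and> t = j)
       then (if j = p then jordan_block l lam else 1\<^sub>m l) $$ (r, c)
       else 0)"

text \<open>
  The space at the vertex \<open>v\<close> is the direct sum of the copies \<open>V\<^sub>j\<close> of \<open>\<K>\<^sup>l\<close> with \<open>u\<^sub>j = v\<close>,
  in increasing order of \<open>j\<close>, so the maps are block matrices. The position of the Jordan
  block is a parameter: it is placed on the map given by \<open>rev \<bb> ! p\<close>.
\<close>
definition band_module ::
  "('v, 'e) pre_digraph \<Rightarrow> 'e syllable list \<Rightarrow> nat \<Rightarrow> nat \<Rightarrow> 'k :: field \<Rightarrow>
    ('v, 'e, 'k) quiver_rep" where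
  "band_module Q \<bb> p l lam =
     \<lparr> rep_dim = (\<lambda>v. l * length (positions_at Q \<bb> v)),
       rep_map = (\<lambda>e.
         let P = positions_at Q \<bb> (head Q e); S = positions_at Q \<bb> (tail Q e)
         in mat (l * length P) (l * length S) (\<lambda>(r, c).
              band_block \<bb> p l lam e (P ! (r div l)) (S ! (c div l)) $$ (r mod l, c mod l))) \<rparr>"

datatype arrow = ArrowA nat | ArrowB nat

fun arrow_index :: "arrow \<Rightarrow> nat" where
  "arrow_index (ArrowA i) = i"
| "arrow_index (ArrowB i) = i"

definition Lambda_quiver :: "nat \<Rightarrow> (nat, arrow) pre_digraph" where
  "Lambda_quiver N =
     \<lparr> verts = {1..N},
       arcs = ArrowA ` {1..N - 1} \<union> ArrowB ` {1..N - 1},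
       tail = (\<lambda>e. arrow_index e + 1),
       head = arrow_index \<rparr>"

definition Lambda_relations :: "nat \<Rightarrow> (arrow \<times> arrow) set" where
  "Lambda_relations N =
     (\<Union>i \<in> {1..N - 2}. {(ArrowA i, ArrowB (i + 1)), (ArrowB i, ArrowA (i + 1))})"

definition elementary_walk :: "nat \<Rightarrow> nat \<Rightarrow> arrow syllable list" where
  "elementary_walk i j =
     (if i < j then map (\<lambda>m. Inverse (ArrowB m)) (rev [i..<j])
      else map (\<lambda>m. Direct (ArrowA m)) [j..<i])"

definition phi_tilde :: "nat list \<Rightarrow> arrow syllable list" where
  "phi_tilde w =
     concat (map (\<lambda>i. elementary_walk (w ! i) (w ! (Suc i mod length w))) (rev [0..<length w]))"

end

(*
Let u : Z -> {1..N} be the L-periodic sequence of vertices visited by the band. In Lambda_N every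
a-arrow is traversed forwards and every b-arrow backwards, so an endomorphism f of the band module
relates the entry f(x, y) only to f(x + 1, y + 1) and f(x - 1, y - 1). Along the diagonal f is
constant. Off the diagonal the entry survives exactly along stretches on which two translates of u
agree and which both translates leave, at either end, with the walk of the row index above the walk
of the column index. So non-scalar endomorphisms exist iff two translates of u touch like this
("pinch"). Reading off the turning points, a touch on a stretch that contains a common turning point
is obstruction (1), and a touch within a single monotone run of both walks is obstruction (2).
*)

theory Submission
  imports Defs
begin

section \<open>Periodic lattice paths\<close>

text \<open>The heights of a step determine its arrow and the direction of travel, so a stretch of
  the walk is only ever matched with a translate, never with a reversed copy. The band is cyclic,
  which raises three questions of size. Two different translates must part on both sides of a common
  point: this is where primitivity enters. A shared stretch of letters together with its two ends
  must fit into one cyclic permutation of the word: a comparison of letter sums shows that it does.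
  A touching stretch of the walk must be shorter than one period, so that the pairs of positions on
  it can be prescribed independently: at the point one period after the left end the walks differ
  again. The scalar \<open>lam\<close> occurs only as a nonzero multiplier of one step. It is
  absorbed along a stretch with two ends and cancels on the diagonal, which makes the criterion the
  same for every nonzero \<open>lam\<close>. Reversing the walk and negating the heights spare
  mirror images of the combinatorial arguments.\<close>

definition pinch :: "(int \<Rightarrow> int) \<Rightarrow> bool" where
  "pinch f \<longleftrightarrow> (\<exists>s t r. 1 \<le> r \<and> f s < f t \<and> (\<forall>i. 1 \<le> i \<and> i \<le> r \<longrightarrow> f (s + i) = f (t + i)) \<and>
     f (s + r + 1) < f (t + r + 1))"

text \<open>Obstruction (2), with run \<open>i\<close> the lower one. As the ends are ordered alike,
  one comparison, of the lower end of the upper run with the upper end of the lower run, says that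
  the closed intervals meet.\<close>

definition crossing_runs :: "(int \<Rightarrow> int) \<Rightarrow> bool" where
  "crossing_runs h \<longleftrightarrow> (\<exists>i j. h i < h j \<and> h (i + 1) < h (j + 1) \<and>
     (h i < h (i + 1) \<and> h j < h (j + 1) \<and> h j \<le> h (i + 1) \<or>
      h (i + 1) < h i \<and> h (j + 1) < h j \<and> h (j + 1) \<le> h i))"

text \<open>Run \<open>i\<close> occupies the positions from \<open>P i\<close> to
  \<open>P (i + 1)\<close>, both included, so consecutive runs share their turning point. Together
  with \<open>neq\<close>, the single equivalence \<open>alt\<close> yields both kinds of
  turn.\<close>

locale zigzag_walk =
  fixes h P u :: "int \<Rightarrow> int"
  assumes neq: "h i \<noteq> h (i + 1)"
    and alt: "h i < h (i + 1) \<longleftrightarrow> h (i + 2) < h (i + 1)"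
    and P_step: "P (i + 1) = P i + \<bar>h (i + 1) - h i\<bar>"
    and u_up: "h i < h (i + 1) \<Longrightarrow> 0 \<le> x \<Longrightarrow> x \<le> h (i + 1) - h i \<Longrightarrow> u (P i + x) = h i + x"
    and u_down: "h (i + 1) < h i \<Longrightarrow> 0 \<le> x \<Longrightarrow> x \<le> h i - h (i + 1) \<Longrightarrow> u (P i + x) = h i - x"
begin

lemma u_P: "u (P i) = h i"
  using neq[of i] u_up[of i 0] u_down[of i 0] by (cases "h i < h (i + 1)") auto

lemma u_up':
  assumes "h i < h (i + 1)" "P i \<le> x" "x \<le> P (i + 1)"
  shows "u x = h i + (x - P i)"
  using u_up[of i "x - P i"] P_step[of i] assms by simp

lemma u_down':
  assumes "h (i + 1) < h i" "P i \<le> x" "x \<le> P (i + 1)"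
  shows "u x = h i - (x - P i)"
  using u_down[of i "x - P i"] P_step[of i] assms by simp

section \<open>Where two walks part, compared with their letters\<close>

lemma up_next: "h i < h (i + 1) \<Longrightarrow> u (P (i + 1) + 1) = h (i + 1) - 1"
  using alt[of i] u_down[of "i + 1" 1] by (simp add: add.assoc)

lemma down_next: "h (i + 1) < h i \<Longrightarrow> u (P (i + 1) + 1) = h (i + 1) + 1"
  using alt[of i] neq[of "i + 1"] u_up[of "i + 1" 1] by (simp add: add.assoc)

text \<open>Two runs in the same direction stay together until the shorter one ends. Among ascending
  runs the one with the lower end turns down first, among descending runs the one with the higher
  end turns up first; either way the walk with the lower next letter ends up below. Runs in opposite
  directions part at once.\<close>

lemma diverge:
  assumes "h a = h b" "h (a + 1) < h (b + 1)"
  shows "\<exists>x\<ge>1. (\<forall>y. 0 \<le> y \<and> y < x \<longrightarrow> u (P a + y) = u (P b + y)) \<and> u (P a + x) < u (P b + x)"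
proof -
  consider "h a < h (a + 1)" | "h (b + 1) < h b" | "h (a + 1) < h a" "h b < h (b + 1)"
    using neq[of a] neq[of b] assms by linarith
  then show ?thesis
  proof cases
    case 1
    let ?x = "h (a + 1) - h a + 1"
    have "u (P a + ?x) = h (a + 1) - 1"
      using up_next[OF 1] P_step[of a] 1 by (simp add: algebra_simps)
    moreover have "u (P b + ?x) = h (a + 1) + 1"
      using u_up[of b ?x] 1 assms by simp
    moreover have "u (P a + y) = u (P b + y)" if "0 \<le> y" "y < ?x" for y
      using u_up[of a y] u_up[of b y] that 1 assms by simp
    ultimately show ?thesis using 1 by (intro exI[of _ ?x]) auto
  next
    case 2
    let ?x = "h b - h (b + 1) + 1"
    have "u (P b + ?x) = h (b + 1) + 1"
      using down_next[OF 2] P_step[of b] 2 by (simp add: algebra_simps)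
    moreover have "u (P a + ?x) = h (b + 1) - 1"
      using u_down[of a ?x] 2 assms by simp
    moreover have "u (P a + y) = u (P b + y)" if "0 \<le> y" "y < ?x" for y
      using u_down[of a y] u_down[of b y] that 2 assms by simp
    ultimately show ?thesis using 2 by (intro exI[of _ ?x]) auto
  next
    case 3
    then have "u (P a + 1) < u (P b + 1)"
      using u_down[of a 1] u_up[of b 1] assms by simp
    moreover have "u (P a + y) = u (P b + y)" if "0 \<le> y" "y < 1" for y
      using that assms by (cases "y = 0") (auto simp: u_P)
    ultimately show ?thesis by (intro exI[of _ 1]) auto
  qed
qed

lemma run_match:
  assumes "h a = h b" "h (a + 1) = h (b + 1)"
  shows "P (a + 1) - P a = P (b + 1) - P b"
    and "0 \<le> y \<Longrightarrow> y \<le> P (a + 1) - P a \<Longrightarrow> u (P a + y) = u (P b + y)"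
proof -
  show "P (a + 1) - P a = P (b + 1) - P b" using P_step[of a] P_step[of b] assms by simp
  assume y: "0 \<le> y" "y \<le> P (a + 1) - P a"
  consider "h a < h (a + 1)" | "h (a + 1) < h a" using neq[of a] by linarith
  then show "u (P a + y) = u (P b + y)"
  proof cases
    case 1
    then show ?thesis using u_up[of a y] u_up[of b y] y P_step[of a] assms by simp
  next
    case 2
    then show ?thesis using u_down[of a y] u_down[of b y] y P_step[of a] assms by simp
  qed
qed

lemma right_diverge:
  assumes "\<forall>x. 0 \<le> x \<and> x \<le> int l \<longrightarrow> h (a + x) = h (b + x)"
    and "h (a + int l + 1) < h (b + int l + 1)"
  shows "\<exists>x\<ge>1. (\<forall>y. 0 \<le> y \<and> y < x \<longrightarrow> u (P a + y) = u (P b + y)) \<and> u (P a + x) < u (P b + x)"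
  using assms
proof (induction l arbitrary: a b)
  case 0
  then show ?case using diverge[of a b] 0(1)[rule_format, of 0] 0(2) by simp
next
  case (Suc l)
  have eq: "h a = h b" "h (a + 1) = h (b + 1)"
    using Suc.prems(1)[rule_format, of 0] Suc.prems(1)[rule_format, of 1] by auto
  have "\<forall>x. 0 \<le> x \<and> x \<le> int l \<longrightarrow> h (a + 1 + x) = h (b + 1 + x)"
    using Suc.prems(1) by (auto simp: add.assoc)
  moreover have "h (a + 1 + int l + 1) < h (b + 1 + int l + 1)"
    using Suc.prems(2) by (simp add: algebra_simps)
  ultimately obtain x where x: "x \<ge> 1" "u (P (a + 1) + x) < u (P (b + 1) + x)"
    and y: "\<And>y. 0 \<le> y \<Longrightarrow> y < x \<Longrightarrow> u (P (a + 1) + y) = u (P (b + 1) + y)"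
    using Suc.IH by blast
  let ?D = "P (a + 1) - P a"
  have D: "P (a + 1) = P a + ?D" "P (b + 1) = P b + ?D" "0 \<le> ?D"
    using run_match(1)[OF eq] P_step[of a] by auto
  have "u (P a + y) = u (P b + y)" if "0 \<le> y" "y < ?D + x" for y
  proof (cases "y \<le> ?D")
    case True
    then show ?thesis using run_match(2)[OF eq] that by simp
  next
    case False
    have "u (P (a + 1) + (y - ?D)) = u (P (b + 1) + (y - ?D))"
      by (rule y) (use False that in auto)
    moreover have "P (a + 1) + (y - ?D) = P a + y" "P (b + 1) + (y - ?D) = P b + y"
      using D by auto
    ultimately show ?thesis by simp
  qed
  moreover have "u (P a + (?D + x)) < u (P b + (?D + x))"
    using x(2) D by (metis add.assoc)
  ultimately show ?case using x(1) D by (intro exI[of _ "?D + x"]) auto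
qed

text \<open>Converse of \<open>right_diverge\<close>, by removing one common run at a time. The
  order of the next letters cannot be the wrong one: \<open>diverge\<close> would then put walk
  \<open>b\<close> below walk \<open>a\<close> at the first difference, which is the one at
  \<open>r\<close>.\<close>

lemma right_letters:
  assumes "h a = h b" "1 \<le> r" "\<forall>y. 0 \<le> y \<and> y < r \<longrightarrow> u (P a + y) = u (P b + y)"
    and "u (P a + r) < u (P b + r)"
  shows "\<exists>l\<ge>0. (\<forall>x. 0 \<le> x \<and> x \<le> l \<longrightarrow> h (a + x) = h (b + x)) \<and> h (a + l + 1) < h (b + l + 1)"
  using assms
proof (induction "nat r" arbitrary: a b r rule: less_induct)
  case less
  note pr = less.prems
  consider "h (a + 1) < h (b + 1)" | "h (b + 1) < h (a + 1)" | "h (a + 1) = h (b + 1)"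
    by linarith
  then show ?case
  proof cases
    case 1
    then show ?thesis using pr(1) by (intro exI[of _ 0]) auto
  next
    case 2
    obtain x where x: "x \<ge> 1" "u (P b + x) < u (P a + x)"
      "\<And>y. 0 \<le> y \<Longrightarrow> y < x \<Longrightarrow> u (P b + y) = u (P a + y)"
      using diverge[of b a] pr(1) 2 by auto
    then have "\<not> x < r" using pr(3)[rule_format, of x] by auto
    moreover have "\<not> r < x" using x(3)[of r] pr(2,4) by auto
    ultimately have "x = r" by simp
    then show ?thesis using x(2) pr(4) by simp
  next
    case 3
    let ?D = "P (a + 1) - P a"
    have D: "P (a + 1) = P a + ?D" "P (b + 1) = P b + ?D" "1 \<le> ?D"
      using run_match(1)[OF pr(1) 3] P_step[of a] neq[of a] by auto
    \<comment> \<open>Along a common run the walks agree up to and including its end, so the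
      difference at \<open>r\<close> lies strictly beyond.\<close>
    have rD: "?D < r"
      using run_match(2)[OF pr(1) 3, of r] pr(2,4) by force
    have shift: "P (a + 1) + y = P a + (y + ?D)" "P (b + 1) + y = P b + (y + ?D)" for y
      using D by auto
    have "u (P (a + 1) + y) = u (P (b + 1) + y)" if "0 \<le> y" "y < r - ?D" for y
      unfolding shift using pr(3)[rule_format, of "y + ?D"] that D(3) by linarith
    moreover have "u (P (a + 1) + (r - ?D)) < u (P (b + 1) + (r - ?D))"
      unfolding shift using pr(4) by simp
    ultimately have "\<exists>l\<ge>0. (\<forall>x. 0 \<le> x \<and> x \<le> l \<longrightarrow> h (a + 1 + x) = h (b + 1 + x)) \<and>
        h (a + 1 + l + 1) < h (b + 1 + l + 1)"
      using D(3) 3 rD by (intro less.hyps[of "r - ?D"]) auto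
    then obtain l where l: "l \<ge> 0" "\<And>x. 0 \<le> x \<Longrightarrow> x \<le> l \<Longrightarrow> h (a + 1 + x) = h (b + 1 + x)"
        "h (a + 1 + l + 1) < h (b + 1 + l + 1)"
      by blast
    have "h (a + x) = h (b + x)" if "0 \<le> x" "x \<le> l + 1" for x
      using l(2)[of "x - 1"] that pr(1) by (cases "x = 0") auto
    then show ?thesis using l(1,3) by (intro exI[of _ "l + 1"]) (auto simp: algebra_simps)
  qed
qed

section \<open>Runs and turning points seen from the walk\<close>

lemma run_containing: "\<exists>i. P i \<le> x \<and> x < P (i + 1)"
proof -
  have inc: "P i < P (i + 1)" for i
    using P_step[of i] neq[of i] by simp
  show ?thesis
  proof (induction x rule: int_induct[where k = "P 0"])
    case base
    then show ?case using inc[of 0] by auto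
  next
    case (step1 x)
    then obtain i where "P i \<le> x" "x < P (i + 1)" by blast
    then show ?case
      using inc[of "i + 1"] by (cases "x + 1 = P (i + 1)") (force intro: exI[of _ i] exI[of _ "i + 1"])+
  next
    case (step2 x)
    then obtain i where "P i \<le> x" "x < P (i + 1)" by blast
    then show ?case
      using inc[of "i - 1"]
      by (cases "x = P i") (force intro: exI[of _ i] exI[of _ "i - 1"])+
  qed
qed

lemma interior:
  assumes "P i < x" "x < P (i + 1)"
  shows "h i < h (i + 1) \<Longrightarrow> u (x + 1) = u x + 1 \<and> u (x - 1) = u x - 1"
    and "h (i + 1) < h i \<Longrightarrow> u (x + 1) = u x - 1 \<and> u (x - 1) = u x + 1"
  using assms P_step[of i] u_up[of i "x - P i"] u_up[of i "x + 1 - P i"] u_up[of i "x - 1 - P i"]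
    u_down[of i "x - P i"] u_down[of i "x + 1 - P i"] u_down[of i "x - 1 - P i"] by auto

text \<open>Turning points are recognised from \<open>u\<close> alone. This lets statements about
  the walk, such as a period of \<open>u\<close>, be converted into statements about
  letters.\<close>

lemma turning_point:
  assumes "u (x + 1) = u (x - 1)"
  shows "\<exists>i. x = P i"
proof -
  obtain i where i: "P i \<le> x" "x < P (i + 1)" using run_containing by blast
  have "x = P i"
  proof (rule ccontr)
    assume "x \<noteq> P i"
    then have "P i < x" using i by simp
    then show False using interior[OF _ i(2)] neq[of i] assms by (cases "h i < h (i + 1)") auto
  qed
  then show ?thesis ..
qed

lemma alt_prev: "h (i - 1) < h i \<longleftrightarrow> h (i + 1) < h i"
  using alt[of "i - 1"] by (simp add: add.commute)

lemma up_prev: "h i < h (i + 1) \<Longrightarrow> u (P i - 1) = h i + 1"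
  using alt_prev[of i] neq[of "i - 1"] u_down'[of "i - 1" "P i - 1"] P_step[of "i - 1"]
  by auto

lemma down_prev: "h (i + 1) < h i \<Longrightarrow> u (P i - 1) = h i - 1"
  using alt_prev[of i] neq[of "i - 1"] u_up'[of "i - 1" "P i - 1"] P_step[of "i - 1"]
  by auto

lemma turning_P: "u (P i + 1) = u (P i - 1)"
  using neq[of i] up_prev[of i] down_prev[of i] u_up[of i 1] u_down[of i 1]
  by (cases "h i < h (i + 1)") auto

lemma u_step: "u (x + 1) = u x + 1 \<or> u (x + 1) = u x - 1"
proof -
  obtain i where i: "P i \<le> x" "x < P (i + 1)" using run_containing by blast
  then show ?thesis using u_up'[of i x] u_up'[of i "x + 1"] u_down'[of i x] u_down'[of i "x + 1"] neq[of i]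
    by (cases "h i < h (i + 1)") auto
qed

section \<open>Symmetries of zigzag walks\<close>

lemma reversed: "zigzag_walk (\<lambda>i. h (- i)) (\<lambda>i. - P (- i)) (\<lambda>x. u (- x))"
proof
  fix i x :: int
  \<comment> \<open>Run \<open>i\<close> of the reversed walk is run \<open>- i - 1\<close> of the
    original one, traversed backwards.\<close>
  have e: "- (i + 1) = - i - 1" "- (i + 2) = - i - 1 - 1" by simp_all
  have arith: "- i - 1 - 1 + 2 = - i" by simp
  show "h (- i) \<noteq> h (- (i + 1))" using neq[of "- i - 1"] by (simp add: e)
  show "h (- i) < h (- (i + 1)) \<longleftrightarrow> h (- (i + 2)) < h (- (i + 1))"
    unfolding e using alt[of "- i - 1 - 1"] neq[of "- i - 1 - 1"] neq[of "- i - 1"]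
    by (simp only: diff_add_cancel arith; auto)
  show "- P (- (i + 1)) = - P (- i) + \<bar>h (- (i + 1)) - h (- i)\<bar>"
    unfolding e using P_step[of "- i - 1"] by simp
  show "u (- (- P (- i) + x)) = h (- i) + x"
    if "h (- i) < h (- (i + 1))" "0 \<le> x" "x \<le> h (- (i + 1)) - h (- i)"
  proof -
    have "u (P (- i) - x) = h (- i - 1) - (P (- i) - x - P (- i - 1))"
      using that P_step[of "- i - 1"] unfolding e by (intro u_down') auto
    moreover have "\<bar>h (- i) - h (- i - 1)\<bar> = \<bar>h (- (i + 1)) - h (- i)\<bar>"
      "- (- P (- i) + x) = P (- i) - x" unfolding e by simp_all
    ultimately show ?thesis using that P_step[of "- i - 1"] unfolding e by (simp only: diff_add_cancel; linarith)
  qed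
  show "u (- (- P (- i) + x)) = h (- i) - x"
    if "h (- (i + 1)) < h (- i)" "0 \<le> x" "x \<le> h (- i) - h (- (i + 1))"
  proof -
    have "u (P (- i) - x) = h (- i - 1) + (P (- i) - x - P (- i - 1))"
      using that P_step[of "- i - 1"] unfolding e by (intro u_up') auto
    moreover have "\<bar>h (- i) - h (- i - 1)\<bar> = \<bar>h (- (i + 1)) - h (- i)\<bar>"
      "- (- P (- i) + x) = P (- i) - x" unfolding e by simp_all
    ultimately show ?thesis using that P_step[of "- i - 1"] unfolding e by (simp only: diff_add_cancel; linarith)
  qed
qed

text \<open>Exchanges ascents and descents. A pinch remains a pinch with its two translates swapped
  (\<open>pinch_neg\<close>), so cases with descending runs reduce to ascending ones.\<close>

lemma negated: "zigzag_walk (\<lambda>i. - h i) P (\<lambda>x. - u x)"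
proof
  fix i x :: int
  show "- h i \<noteq> - h (i + 1)" using neq by simp
  show "- h i < - h (i + 1) \<longleftrightarrow> - h (i + 2) < - h (i + 1)"
    using alt[of i] neq[of i] neq[of "i + 1"] by (auto simp: add.assoc)
  show "P (i + 1) = P i + \<bar>- h (i + 1) - - h i\<bar>" using P_step[of i] by simp
  show "- u (P i + x) = - h i + x" if "- h i < - h (i + 1)" "0 \<le> x" "x \<le> - h (i + 1) - - h i"
    using u_down[of i x] that by simp
  show "- u (P i + x) = - h i - x" if "- h (i + 1) < - h i" "0 \<le> x" "x \<le> - h i - - h (i + 1)"
    using u_up[of i x] that by simp
qed

lemma left_diverge:
  assumes "h b = h a" "h (a - 1) < h (b - 1)"
  shows "\<exists>x\<ge>1. (\<forall>y. 0 \<le> y \<and> y < x \<longrightarrow> u (P a - y) = u (P b - y)) \<and> u (P a - x) < u (P b - x)"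
  using zigzag_walk.diverge[OF reversed, of "- a" "- b"] assms by (simp add: algebra_simps)

lemma left_letters:
  assumes "h a = h b" "1 \<le> r" "\<forall>y. 0 \<le> y \<and> y < r \<longrightarrow> u (P a - y) = u (P b - y)"
    and "u (P a - r) < u (P b - r)"
  shows "\<exists>l\<ge>0. (\<forall>x. 0 \<le> x \<and> x \<le> l \<longrightarrow> h (a - x) = h (b - x)) \<and> h (a - l - 1) < h (b - l - 1)"
  using zigzag_walk.right_letters[OF reversed, of "- a" "- b" r] assms
  by (simp add: algebra_simps)

section \<open>From the letters to the walk\<close>

lemma pinch_letters_imp: "pinch h \<Longrightarrow> pinch u"
proof -
  assume "pinch h"
  then obtain i j r where ij: "1 \<le> r" "h i < h j"
    "\<And>x. 1 \<le> x \<Longrightarrow> x \<le> r \<Longrightarrow> h (i + x) = h (j + x)" "h (i + r + 1) < h (j + r + 1)"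
    unfolding pinch_def by blast
  \<comment> \<open>The first common letter: \<open>r - 1\<close> further ones follow on its right,
    while on its left the letters differ at once, so that \<open>left_diverge\<close> suffices
    there.\<close>
  let ?a = "i + 1" and ?b = "j + 1"
  have "\<exists>x\<ge>1. (\<forall>y. 0 \<le> y \<and> y < x \<longrightarrow> u (P ?a + y) = u (P ?b + y)) \<and> u (P ?a + x) < u (P ?b + x)"
    using ij(1) ij(3)[of "1 + x" for x] ij(4)
    by (intro right_diverge[of "nat (r - 1)"]) (auto simp: add.assoc)
  then obtain x where x: "x \<ge> 1" "u (P ?a + x) < u (P ?b + x)"
    "\<And>y. 0 \<le> y \<Longrightarrow> y < x \<Longrightarrow> u (P ?a + y) = u (P ?b + y)" by blast
  obtain x' where x': "x' \<ge> 1" "u (P ?a - x') < u (P ?b - x')"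
    "\<And>y. 0 \<le> y \<Longrightarrow> y < x' \<Longrightarrow> u (P ?a - y) = u (P ?b - y)"
    using left_diverge[of ?b ?a] ij(1,2) ij(3)[of 1] by auto
  have "u (P ?a - x' + y) = u (P ?b - x' + y)" if "1 \<le> y" "y \<le> x + x' - 1" for y
    using x(3)[of "y - x'"] x'(3)[of "x' - y"] that
    by (cases "y < x'") (auto simp: algebra_simps)
  then show ?thesis
    unfolding pinch_def
    by (intro exI[of _ "P ?a - x'"] exI[of _ "P ?b - x'"] exI[of _ "x + x' - 1"])
       (use x x' in \<open>auto simp: algebra_simps\<close>)
qed

text \<open>The runs share the heights from \<open>h j\<close> to \<open>h (i + 1)\<close>. At the
  bottom, walk \<open>i\<close> arrives from below and walk \<open>j\<close> turns in its valley,
  coming from above; at the top, walk \<open>i\<close> turns back at its peak while walk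
  \<open>j\<close> climbs on. The witnesses \<open>?s\<close> and \<open>?t\<close> are one step
  before the shared heights.\<close>

lemma crossing_up_imp:
  assumes "h i < h j" "h (i + 1) < h (j + 1)" "h i < h (i + 1)" "h j < h (j + 1)" "h j \<le> h (i + 1)"
  shows "pinch u"
proof -
  let ?r = "h (i + 1) - h j + 1"
  let ?s = "P i + (h j - h i) - 1" and ?t = "P j - 1"
  have "u ?s = h j - 1" using u_up[of i "h j - h i - 1"] assms by (simp add: algebra_simps)
  moreover have "u ?t = h j + 1" using up_prev[of j] assms by simp
  moreover have "u (?s + y) = u (?t + y)" if "1 \<le> y" "y \<le> ?r" for y
    using u_up[of i "h j - h i + y - 1"] u_up[of j "y - 1"] that assms
    by (simp add: algebra_simps)
  moreover have "u (?s + ?r + 1) = h (i + 1) - 1"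
    using up_next[of i] P_step[of i] assms by (simp add: algebra_simps)
  moreover have "u (?t + ?r + 1) = h (i + 1) + 1"
    using u_up[of j ?r] assms by (simp add: algebra_simps)
  ultimately show ?thesis
    unfolding pinch_def using assms(5)
    by (intro exI[of _ ?s] exI[of _ ?t] exI[of _ ?r]) auto
qed

end

lemma pinch_neg: "pinch (\<lambda>x. - f x) \<longleftrightarrow> pinch f"
proof -
  have "pinch f \<Longrightarrow> pinch (\<lambda>x. - f x)" for f :: "int \<Rightarrow> int"
    unfolding pinch_def neg_less_iff_less neg_equal_iff_equal by metis
  from this[of f] this[of "\<lambda>x. - f x"] show ?thesis by auto
qed

lemma crossing_runs_neg: "crossing_runs (\<lambda>x. - f x) \<Longrightarrow> crossing_runs f"
  unfolding crossing_runs_def by (metis neg_le_iff_le neg_less_iff_less)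

section \<open>From the walk back to the letters\<close>

context zigzag_walk
begin

lemma crossing_runs_imp: "crossing_runs h \<Longrightarrow> pinch u"
  unfolding crossing_runs_def
  using crossing_up_imp zigzag_walk.crossing_up_imp[OF negated] pinch_neg[of u]
  by (auto simp only: neg_less_iff_less neg_le_iff_le) 

text \<open>A common turning point aligns the letter indices as well as the positions. From there
  the letters can be read off in both directions, and the first differing letters inherit the order
  in which the walks part.\<close>

lemma common_turning_imp:
  assumes "h a = h b" "1 \<le> m" "m \<le> r" "P a = s + m" "P b = t + m"
    and "u s < u t" "\<forall>i. 1 \<le> i \<and> i \<le> r \<longrightarrow> u (s + i) = u (t + i)" "u (s + r + 1) < u (t + r + 1)"
  shows "pinch h"
proof -
  have "\<exists>l\<ge>0. (\<forall>x. 0 \<le> x \<and> x \<le> l \<longrightarrow> h (a + x) = h (b + x)) \<and> h (a + l + 1) < h (b + l + 1)"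
    using assms by (intro right_letters[of _ _ "r - m + 1"]) (auto simp: add.assoc)
  then obtain l where l: "l \<ge> 0" "\<And>x. 0 \<le> x \<Longrightarrow> x \<le> l \<Longrightarrow> h (a + x) = h (b + x)"
    "h (a + l + 1) < h (b + l + 1)" by blast
  have "u (P a - y) = u (P b - y)" if "0 \<le> y" "y < m" for y
    using assms(7)[rule_format, of "m - y"] assms(3-5) that by (simp add: algebra_simps)
  then have "\<exists>l\<ge>0. (\<forall>x. 0 \<le> x \<and> x \<le> l \<longrightarrow> h (a - x) = h (b - x)) \<and> h (a - l - 1) < h (b - l - 1)"
    using assms(1-6) by (intro left_letters[of _ _ m]) auto
  then obtain l' where l': "l' \<ge> 0" "\<And>x. 0 \<le> x \<Longrightarrow> x \<le> l' \<Longrightarrow> h (a - x) = h (b - x)"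
    "h (a - l' - 1) < h (b - l' - 1)" by blast
  have "h (a - l' - 1 + y) = h (b - l' - 1 + y)" if "1 \<le> y" "y \<le> l + l' + 1" for y
    using l(2)[of "y - l' - 1"] l'(2)[of "l' + 1 - y"] that
    by (cases "y \<le> l'") (auto simp: algebra_simps)
  then show ?thesis
    unfolding pinch_def
    by (intro exI[of _ "a - l' - 1"] exI[of _ "b - l' - 1"] exI[of _ "l + l' + 1"])
       (use l l' in \<open>auto simp: algebra_simps\<close>)
qed

text \<open>Walk \<open>s\<close> enters the stretch from below and does not turn at its first
  point, so it is climbing; walk \<open>t\<close> enters from above and must turn there. It remains
  to see which ascending run ends first. If it is run \<open>a\<close>, the runs form obstruction
  (2); if both end together, their ends are a common turning point; if it is run \<open>b\<close>,
  walk \<open>t\<close> would leave the stretch below walk \<open>s\<close>.\<close>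

lemma pinch_inside_up_imp:
  assumes r: "1 \<le> r" and st: "u s < u t" and eq: "\<forall>i. 1 \<le> i \<and> i \<le> r \<longrightarrow> u (s + i) = u (t + i)"
    and e: "u (s + r + 1) < u (t + r + 1)"
    and a: "P a < s + 1" "s + 1 < P (a + 1)"
  shows "pinch h \<or> crossing_runs h"
proof -
  have s1: "u (s + 1) = u (t + 1)" using eq r by auto
  have us: "u s = u (s + 1) - 1" "u t = u (t + 1) + 1"
    using u_step[of s] u_step[of t] st s1 by auto
  have up: "h a < h (a + 1)"
    using interior(2)[OF a] us neq[of a] by force
  have us2: "u (s + 2) = u (s + 1) + 1"
    using interior(1)[OF a up] by (simp add: add.assoc)
  \<comment> \<open>For \<open>r = 1\<close> the bound comes from the order in which the walks part,
    otherwise from the second shared point.\<close>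
  then have "u (t + 2) \<ge> u (t + 1) + 1"
    using eq[rule_format, of 2] e s1 r by (cases "r = 1") (auto simp: add.assoc)
  then have t2: "u (t + 2) = u (t + 1) + 1"
    using u_step[of "t + 1"] by (auto simp: add.assoc)
  then obtain b where b: "t + 1 = P b"
    using turning_point[of "t + 1"] us(2) by (auto simp: add.assoc)
  have upb: "h b < h (b + 1)"
    using t2 u_down[of b 1] neq[of b] u_P[of b] by (fastforce simp flip: b simp: add.assoc)
  let ?m = "s + 1 - P a"
  have hb: "h b = h a + ?m"
    using u_up[OF up, of ?m] u_P[of b] a P_step[of a] up s1 b by simp
  have inside: "u (s + y) = h b + y - 1" if "1 \<le> y" "y \<le> h (a + 1) - h b + 1" for y
    using u_up'[OF up, of "s + y"] that a P_step[of a] up hb by simp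
  have inside': "u (t + y) = h b + y - 1" if "1 \<le> y" "y \<le> h (b + 1) - h b + 1" for y
    using u_up'[OF upb, of "t + y"] P_step[of b] upb that b by simp
  have ba: "h b < h (a + 1)" using hb a P_step[of a] up by simp
  consider "h (a + 1) < h (b + 1)" | "h (a + 1) = h (b + 1)" | "h (b + 1) < h (a + 1)" by linarith
  then show ?thesis
  proof cases
    case 1
    then have "crossing_runs h"
      unfolding crossing_runs_def using hb ba up upb a by (intro exI[of _ a] exI[of _ b]) auto
    then show ?thesis ..
  next
    case 2
    let ?k = "h (a + 1) - h b + 1"
    \<comment> \<open>Otherwise the stretch would end while both walks are still on their ascending
      runs, and they would agree at \<open>r + 1\<close> as well.\<close>
    have "?k \<le> r"
    proof (rule ccontr)
      assume "\<not> ?thesis"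
      then show False using inside[of "r + 1"] inside'[of "r + 1"] r e 2 by (simp add: add.assoc)
    qed
    then have "pinch h"
      using 2 st eq e ba P_step[of a] P_step[of b] up upb hb b
      by (intro common_turning_imp[of "a + 1" "b + 1" ?k r s t]) auto
    then show ?thesis ..
  next
    case 3
    let ?k = "h (b + 1) - h b + 1"
    have "u (t + (?k + 1)) = h (b + 1) - 1"
    proof -
      have "P (b + 1) + 1 = t + (?k + 1)" using P_step[of b] upb b by simp
      then show ?thesis using up_next[OF upb] by metis
    qed
    moreover have "u (s + (?k + 1)) = h (b + 1) + 1"
      using inside[of "?k + 1"] 3 upb by (simp add: algebra_simps)
    moreover have "?k \<le> r"
    proof (rule ccontr)
      assume "\<not> ?thesis"
      then show False using inside[of "r + 1"] inside'[of "r + 1"] r e 3 by (simp add: add.assoc)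
    qed
    ultimately have False using eq[rule_format, of "?k + 1"] e upb
      by (cases "?k = r") (auto simp: add.assoc)
    then show ?thesis ..
  qed
qed

lemma pinch_walk_imp:
  assumes "pinch u"
  shows "pinch h \<or> crossing_runs h"
proof -
  obtain s t r where st: "1 \<le> r" "u s < u t" "\<forall>i. 1 \<le> i \<and> i \<le> r \<longrightarrow> u (s + i) = u (t + i)"
    "u (s + r + 1) < u (t + r + 1)"
    using assms unfolding pinch_def by blast
  obtain a where a: "P a \<le> s + 1" "s + 1 < P (a + 1)" using run_containing by blast
  obtain b where b: "P b \<le> t + 1" "t + 1 < P (b + 1)" using run_containing by blast
  consider "P a < s + 1" | "P b < t + 1" | "P a = s + 1" "P b = t + 1"
    using a b by linarith
  then show ?thesis
  proof cases
    case 1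
    then show ?thesis using pinch_inside_up_imp[OF st] a by blast
  next
    case 2
    \<comment> \<open>Negation swaps \<open>s\<close> and \<open>t\<close>, so the walk that passes
      straight through again comes from below.\<close>
    have "pinch (\<lambda>x. - h x) \<or> crossing_runs (\<lambda>x. - h x)"
      by (rule zigzag_walk.pinch_inside_up_imp[OF negated, of r t s b]) (use st b 2 in auto)
    then show ?thesis using pinch_neg crossing_runs_neg by blast
  next
    case 3
    have "h a = h b" using u_P[of a] u_P[of b] 3 st(1,3) by simp
    then have "pinch h" using common_turning_imp[of a b 1 r s t] 3 st by simp
    then show ?thesis ..
  qed
qed

theorem pinch_walk_iff: "pinch u \<longleftrightarrow> pinch h \<or> crossing_runs h"
  using pinch_walk_imp pinch_letters_imp crossing_runs_imp by blast

end

section \<open>The walk of a crown\<close>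

lemma length_concat_upt: "length (concat (map f [0..<k])) = (\<Sum>j<k. length (f j))"
  by (induction k) auto

lemma sum_lessThan_Suc_le:
  fixes g :: "nat \<Rightarrow> nat"
  assumes "i < k"
  shows "(\<Sum>j<i. g j) + g i \<le> (\<Sum>j<k. g j)"
proof -
  have "(\<Sum>j<Suc i. g j) \<le> (\<Sum>j<k. g j)" using assms by (intro sum_mono2) auto
  then show ?thesis by simp
qed

lemma nth_concat_upt:
  assumes "i < k" "x < length (f i)"
  shows "concat (map f [0..<k]) ! ((\<Sum>j<i. length (f j)) + x) = f i ! x"
  using assms
proof (induction k)
  case (Suc k)
  show ?case
  proof (cases "i = k")
    case True
    then show ?thesis by (simp add: nth_append length_concat_upt)
  next
    case False
    with Suc.prems have i: "i < k" by simp
    then have "(\<Sum>j<i. length (f j)) + x < (\<Sum>j<k. length (f j))"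
      using sum_lessThan_Suc_le[OF i, of "\<lambda>j. length (f j)"] Suc.prems by simp
    then show ?thesis using Suc i by (simp add: nth_append length_concat_upt)
  qed
qed simp

lemma index_in_sum:
  fixes g :: "nat \<Rightarrow> nat"
  assumes "n < (\<Sum>j<k. g j)"
  shows "\<exists>i<k. \<exists>x<g i. n = (\<Sum>j<i. g j) + x"
  using assms
proof (induction k)
  case (Suc k)
  show ?case
  proof (cases "n < (\<Sum>j<k. g j)")
    case True
    then show ?thesis using Suc.IH less_SucI by blast
  next
    case False
    then show ?thesis using Suc.prems
      by (intro exI[of _ k] conjI exI[of _ "n - (\<Sum>j<k. g j)"]) auto
  qed
qed simp

text \<open>A rotation that fixes the word makes a prefix commute with the remaining suffix, and
  commuting words are powers of a common word.\<close>

lemma rotate_fixed_not_primitive: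
  assumes "rotate m w = w" "0 < m" "m < length w"
  shows "\<not> primitive_word w"
proof -
  have "take m w @ drop m w = drop m w @ take m w"
    using assms by (simp add: rotate_drop_take)
  then obtain a b zs where zs: "concat (replicate a zs) = take m w" "concat (replicate b zs) = drop m w"
    using comm_append_are_replicate by blast
  have "a \<noteq> 0" "b \<noteq> 0" using zs assms by (auto intro: ccontr)
  moreover have "w = concat (replicate (a + b) zs)"
    using zs by (metis append_take_drop_id concat_append replicate_add)
  ultimately show ?thesis
    unfolding primitive_word_def by (metis One_nat_def Suc_leI add_mono neq0_conv one_add_one)
qed

text \<open>An invariant used later to show that two rotations of a word cannot differ in exactly
  one letter.\<close>

lemma sum_list_rotate: "sum_list (rotate m w) = sum_list (w :: 'a :: comm_monoid_add list)"
proof (induction m)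
  case (Suc m)
  then show ?case by (cases "rotate m w") (auto simp: add.commute)
qed simp

section \<open>The word and its band, unrolled to the integers\<close>

definition letter :: "nat list \<Rightarrow> int \<Rightarrow> int" where
  "letter w i = int (w ! nat (i mod int (length w)))"

text \<open>The reversal restores the order of traversal, since walks are listed with the last step
  first.\<close>

definition run_walk :: "nat list \<Rightarrow> nat \<Rightarrow> arrow syllable list" where
  "run_walk w i = rev (elementary_walk (w ! i) (w ! (Suc i mod length w)))"

text \<open>The position on the walk at which letter \<open>i\<close> is reached. Advancing
  \<open>i\<close> by one period of the word adds one period of the walk.\<close>

definition turn_index :: "nat list \<Rightarrow> int \<Rightarrow> int" where
  "turn_index w i = i div int (length w) * int (length (phi_tilde w)) +
     int (\<Sum>j<nat (i mod int (length w)). length (run_walk w j))"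

text \<open>The heads and tails in \<open>Lambda_quiver N\<close> do not depend on \<open>N\<close>, so \<open>N = 0\<close> loses nothing.\<close>
definition height :: "nat list \<Rightarrow> int \<Rightarrow> int" where
  "height w x = int (walk_vertex (Lambda_quiver 0) (phi_tilde w) (nat (x mod int (length (phi_tilde w)))))"

lemma walk_vertex_Lambda: "walk_vertex (Lambda_quiver N) b j = walk_vertex (Lambda_quiver 0) b j"
proof -
  have "syllable_start (Lambda_quiver N) a = syllable_start (Lambda_quiver 0) a"
    "syllable_end (Lambda_quiver N) a = syllable_end (Lambda_quiver 0) a" for a
    by (cases a; simp add: Lambda_quiver_def)+
  then show ?thesis unfolding walk_vertex_def by simp
qed

lemma rev_phi_tilde: "rev (phi_tilde w) = concat (map (run_walk w) [0..<length w])"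
  unfolding phi_tilde_def run_walk_def by (simp add: rev_concat rev_map comp_def)

lemma length_phi_tilde: "length (phi_tilde w) = (\<Sum>j<length w. length (run_walk w j))"
  using arg_cong[OF rev_phi_tilde, of length w] by (simp only: length_rev length_concat_upt)

lemma length_run_walk: "int (length (run_walk w i)) = \<bar>int (w ! (Suc i mod length w)) - int (w ! i)\<bar>"
  unfolding run_walk_def elementary_walk_def by auto

lemma nth_run_walk:
  assumes "x < length (run_walk w i)"
  shows "run_walk w i ! x = (if w ! i < w ! (Suc i mod length w) then Inverse (ArrowB (w ! i + x))
           else Direct (ArrowA (w ! i - 1 - x)))"
  using assms unfolding run_walk_def elementary_walk_def
  by (auto simp: rev_map rev_nth)

lemma letter_of_nat: "i < length w \<Longrightarrow> letter w (int i) = int (w ! i)"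
  unfolding letter_def by simp

lemma letter_Suc:
  assumes "w \<noteq> []"
  shows "letter w (i + 1) = int (w ! (Suc (nat (i mod int (length w))) mod length w))"
proof -
  have "(i + 1) mod int (length w) = int (Suc (nat (i mod int (length w))) mod length w)"
    using assms by (simp add: zmod_int mod_add_right_eq add.commute)
  then show ?thesis unfolding letter_def by simp
qed

lemma rotate_nth_letter:
  assumes "n < length w"
  shows "int (rotate (nat (i mod int (length w))) w ! n) = letter w (i + int n)"
proof -
  have "(i + int n) mod int (length w) = int ((nat (i mod int (length w)) + n) mod length w)"
  proof -
    have "0 \<le> i mod int (length w)" using assms by (intro pos_mod_sign) auto
    then show ?thesis by (simp add: zmod_int mod_add_left_eq)
  qed
  then show ?thesis using assms unfolding letter_def by (simp add: nth_rotate)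
qed

lemma rotate_nth_letter':
  assumes "n < length w"
  shows "int (rotate m w ! n) = letter w (int m + int n)"
  using rotate_nth_letter[OF assms, of "int m"] assms by (simp add: rotate_conv_mod[of m] flip: zmod_int)

lemma letter_periodic: "letter w (i + int (length w)) = letter w i"
  unfolding letter_def by simp

section \<open>The two forbidden patterns as properties of the periodic letter sequence\<close>

lemma pinch_letter_iff:
  assumes "w \<noteq> []"
  shows "(\<exists>n' m' n'' m'' z z' z''.
          cyclic_permutation ([n'] @ z @ [m'] @ z') w \<and>
          cyclic_permutation ([n''] @ z @ [m''] @ z'') w \<and>
          n' < n'' \<and> m' < m'' \<and> length z \<ge> 1) \<longleftrightarrow> pinch (letter w)"
    (is "?L \<longleftrightarrow> ?R")
proof
  assume ?L
  then obtain n' m' n'' m'' z z' z'' a b where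
    rot: "[n'] @ z @ [m'] @ z' = rotate a w" "[n''] @ z @ [m''] @ z'' = rotate b w"
    and less: "n' < n''" "m' < m''" "length z \<ge> 1"
    unfolding cyclic_permutation_def by blast
  let ?l = "length z"
  have len: "length w = 2 + ?l + length z'"
    using arg_cong[OF rot(1), of length] by simp
  have a: "letter w (int a + int n) = int (([n'] @ z @ [m'] @ z') ! n)" if "n < ?l + 2" for n
    using rotate_nth_letter'[of n w a] that len rot(1) by simp
  have b: "letter w (int b + int n) = int (([n''] @ z @ [m''] @ z'') ! n)" if "n < ?l + 2" for n
    using rotate_nth_letter'[of n w b] that len rot(2) by simp
  have "letter w (int a + i) = letter w (int b + i)" if "1 \<le> i" "i \<le> int ?l" for i
    using that a[of "nat i"] b[of "nat i"] by (auto simp: nth_append nth_Cons split: nat.splits)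
  then show ?R
    unfolding pinch_def using a[of 0] b[of 0] a[of "?l + 1"] b[of "?l + 1"] less
    by (intro exI[of _ "int a"] exI[of _ "int b"] exI[of _ "int ?l"])
       (auto simp: nth_append algebra_simps)
next
  assume ?R
  then obtain s t r where st: "1 \<le> r" "letter w s < letter w t"
    "letter w (s + r + 1) < letter w (t + r + 1)"
    and eq: "\<And>i. 1 \<le> i \<Longrightarrow> i \<le> r \<Longrightarrow> letter w (s + i) = letter w (t + i)"
    unfolding pinch_def by blast
  define S where "S = rotate (nat (s mod int (length w))) w"
  define T where "T = rotate (nat (t mod int (length w))) w"
  have S: "int (S ! n) = letter w (s + int n)" if "n < length w" for n
    using rotate_nth_letter that unfolding S_def .
  have T: "int (T ! n) = letter w (t + int n)" if "n < length w" for n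
    using rotate_nth_letter that unfolding T_def .
  have lens: "length S = length w" "length T = length w" unfolding S_def T_def by auto
  define l where "l = nat r"
  have r: "r = int l" "1 \<le> l" using st unfolding l_def by auto
  have ST: "S ! n = T ! n" if "1 \<le> n" "n \<le> l" "n < length w" for n
    using S[of n] T[of n] eq[of "int n"] that r by simp
  have less0: "S ! 0 < T ! 0" using S[of 0] T[of 0] st(2) assms by simp
  \<comment> \<open>Both ends and the shared stretch have to fit into one rotation. If the stretch
    filled the rest of the word, \<open>S\<close> and \<open>T\<close> would differ in their first
    letters only, against the equality of their letter sums.\<close>
  have bound: "l + 1 < length w"
  proof (rule ccontr)
    assume "\<not> ?thesis"
    then have "tl S = tl T" using ST lens by (intro nth_equalityI) (auto simp: nth_tl)
    moreover have "sum_list S = sum_list T"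
      unfolding S_def T_def by (simp add: sum_list_rotate)
    moreover have "S \<noteq> []" "T \<noteq> []" using lens assms by auto
    ultimately have "hd S = hd T" by (cases S; cases T) auto
    then show False using less0 \<open>S \<noteq> []\<close> \<open>T \<noteq> []\<close> by (simp add: hd_conv_nth)
  qed
  have decomp: "X = [X ! 0] @ take l (tl X) @ [X ! (l + 1)] @ drop (l + 2) X"
    if "length X = length w" for X :: "nat list"
  proof -
    have "X \<noteq> []" using that assms by auto
    then have "X = X ! 0 # tl X" by (cases X) auto
    moreover have "tl X = take l (tl X) @ tl X ! l # drop (Suc l) (tl X)"
      using bound that by (intro id_take_nth_drop) auto
    moreover have "tl X ! l = X ! (l + 1)" "drop (Suc l) (tl X) = drop (l + 2) X"
      using bound that by (auto simp: nth_tl drop_Suc)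
    ultimately show ?thesis by (metis append_Cons append_Nil)
  qed
  have "take l (tl S) = take l (tl T)"
    using ST lens bound by (intro nth_equalityI) (auto simp: nth_tl)
  then have "cyclic_permutation ([S ! 0] @ take l (tl S) @ [S ! (l + 1)] @ drop (l + 2) S) w"
    "cyclic_permutation ([T ! 0] @ take l (tl S) @ [T ! (l + 1)] @ drop (l + 2) T) w"
    using decomp[of S] decomp[of T] lens unfolding cyclic_permutation_def S_def T_def by metis+
  moreover have "S ! (l + 1) < T ! (l + 1)"
    using S[OF bound] T[OF bound] st(3) r by (simp add: algebra_simps)
  moreover have "length (take l (tl S)) \<ge> 1" using r bound lens by simp
  ultimately show ?L using less0 by blast
qed

lemma crossing_letter_iff:
  assumes "length w \<ge> 2" "\<And>i. letter w i \<noteq> letter w (i + 1)"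
  shows "(\<exists>n' m' n'' m'' z' z''.
          cyclic_permutation ([n', m'] @ z') w \<and>
          cyclic_permutation ([n'', m''] @ z'') w \<and>
          n' < n'' \<and> m' < m'' \<and> (n' < m' \<longleftrightarrow> n'' < m'') \<and>
          letters_between n' m' \<inter> letters_between n'' m'' \<noteq> {}) \<longleftrightarrow> crossing_runs (letter w)"
    (is "?L \<longleftrightarrow> ?R")
proof
  assume ?L
  then obtain n' m' n'' m'' z' z'' a b where
    rot: "[n', m'] @ z' = rotate a w" "[n'', m''] @ z'' = rotate b w"
    and less: "n' < n''" "m' < m''" "n' < m' \<longleftrightarrow> n'' < m''"
      "letters_between n' m' \<inter> letters_between n'' m'' \<noteq> {}"
    unfolding cyclic_permutation_def by blast
  have "letter w (int a) = int n'" "letter w (int a + 1) = int m'"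
    using rotate_nth_letter'[of 0 w a] rotate_nth_letter'[of 1 w a] assms(1) by (fastforce simp flip: rot)+
  moreover have "letter w (int b) = int n''" "letter w (int b + 1) = int m''"
    using rotate_nth_letter'[of 0 w b] rotate_nth_letter'[of 1 w b] assms(1) by (fastforce simp flip: rot)+
  moreover have "n' \<noteq> m'" "n'' \<noteq> m''" using assms(2)[of "int a"] assms(2)[of "int b"] calculation by auto
  ultimately show ?R
    unfolding crossing_runs_def using less
    by (intro exI[of _ "int a"] exI[of _ "int b"]) (auto simp: letters_between_def min_def max_def split: if_splits)
next
  assume ?R
  then obtain i j where ij: "letter w i < letter w j" "letter w (i + 1) < letter w (j + 1)"
     "letter w i < letter w (i + 1) \<and> letter w j < letter w (j + 1) \<and> letter w j \<le> letter w (i + 1) \<or>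
      letter w (i + 1) < letter w i \<and> letter w (j + 1) < letter w j \<and> letter w (j + 1) \<le> letter w i"
    unfolding crossing_runs_def by blast
  have *: "\<exists>n m z. cyclic_permutation ([n, m] @ z) w \<and> letter w x = int n \<and> letter w (x + 1) = int m" for x
  proof -
    define X where "X = rotate (nat (x mod int (length w))) w"
    have "length X \<ge> 2" using assms(1) unfolding X_def by simp
    then obtain n m z where X: "X = [n, m] @ z" by (metis One_nat_def Suc_1 Suc_le_length_iff append_Cons append_Nil)
    moreover have "letter w x = int (X ! 0)" "letter w (x + 1) = int (X ! 1)"
      using rotate_nth_letter[of 0 w x] rotate_nth_letter[of 1 w x] assms(1) unfolding X_def by fastforce+
    ultimately show ?thesis unfolding cyclic_permutation_def using X_def by (metis append_Cons nth_Cons_0 One_nat_def nth_Cons_Suc)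
  qed
  obtain n' m' z' where 1: "cyclic_permutation ([n', m'] @ z') w" "letter w i = int n'" "letter w (i + 1) = int m'"
    using * by blast
  obtain n'' m'' z'' where 2: "cyclic_permutation ([n'', m''] @ z'') w" "letter w j = int n''" "letter w (j + 1) = int m''"
    using * by blast
  \<comment> \<open>The lower end of the upper run lies in both intervals; it is \<open>n''\<close>
    for ascending and \<open>m''\<close> for descending runs.\<close>
  have "letters_between n' m' \<inter> letters_between n'' m'' \<noteq> {}"
  proof (cases "n' < m'")
    case True
    then have "n'' \<in> letters_between n' m' \<inter> letters_between n'' m''"
      using ij 1 2 unfolding letters_between_def by auto
    then show ?thesis by blast
  next
    case False
    then have "m'' \<in> letters_between n' m' \<inter> letters_between n'' m''"
      using ij 1 2 unfolding letters_between_def by auto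
    then show ?thesis by blast
  qed
  then show ?L using ij 1 2 by (intro exI conjI) (auto)
qed

section \<open>The walk of a crown as a lattice path\<close>

locale crown_word =
  fixes A :: "nat set" and w :: "nat list"
  assumes crown: "crown A w"
begin

abbreviation "L \<equiv> length (phi_tilde w)"
abbreviation "h \<equiv> letter w"
abbreviation "u \<equiv> height w"
abbreviation "turn i \<equiv> (\<Sum>j<i. length (run_walk w j))"

lemma length_w: "length w \<ge> 2" "w \<noteq> []"
  using crown unfolding crown_def by auto

text \<open>Consecutive letters are inspected at the beginning of a suitable rotation, which also
  takes care of the passage from the end of the word to its start.\<close>

lemma letter_neq: "h i \<noteq> h (i + 1)"
  and letter_alt: "h i < h (i + 1) \<longleftrightarrow> h (i + 2) < h (i + 1)"
proof -
  let ?m = "nat (i mod int (length w))"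
  have zz: "zigzag (rotate ?m w)"
    using crown unfolding crown_def cyclic_permutation_def by blast
  have nth: "int (rotate ?m w ! 0) = h i" "int (rotate ?m w ! 1) = h (i + 1)"
    using rotate_nth_letter[of 0 w i] rotate_nth_letter[of 1 w i] length_w by auto
  have "0 < length w - 1" using length_w(1) by simp
  then have "rotate ?m w ! 0 \<noteq> rotate ?m w ! 1"
    using zz length_w(1) unfolding zigzag_def by (auto dest!: spec[of _ 0])
  then show neq: "h i \<noteq> h (i + 1)" using nth by linarith
  show "h i < h (i + 1) \<longleftrightarrow> h (i + 2) < h (i + 1)"
  proof (cases "length w = 2")
    \<comment> \<open>A rotation of a two-letter word has no third letter; periodicity supplies
      it.\<close>
    case True
    then show ?thesis using letter_periodic[of w i] by simp
  next
    case False
    then have 2: "2 < length w" using length_w(1) by simp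
    have "int (rotate ?m w ! 2) = h (i + 2)" using rotate_nth_letter[OF 2, of i] by simp
    moreover have "rotate ?m w ! 0 < rotate ?m w ! 1 \<and> rotate ?m w ! 1 > rotate ?m w ! 2 \<or>
        rotate ?m w ! 0 > rotate ?m w ! 1 \<and> rotate ?m w ! 1 < rotate ?m w ! 2"
      using zz 2 unfolding zigzag_def numeral_2_eq_2
      by (auto dest: spec[of _ 0] spec[of _ 1])
    ultimately show ?thesis using nth by linarith
  qed
qed

lemma run_walk_nonempty: "i < length w \<Longrightarrow> length (run_walk w i) > 0"
  using length_run_walk[of w i] letter_neq[of "int i"] letter_of_nat[of i w] letter_Suc[of w "int i"] length_w
  by auto

lemma turn_length: "turn (length w) = L"
  by (simp add: length_phi_tilde)

lemma turn_Suc_le: "i < length w \<Longrightarrow> turn i + length (run_walk w i) \<le> L"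
  unfolding turn_length[symmetric] by (rule sum_lessThan_Suc_le)

lemma L_pos: "L > 0"
  using turn_Suc_le[of 0] run_walk_nonempty[of 0] length_w by (cases w) auto

lemma nth_walk:
  assumes "i < length w" "x < length (run_walk w i)"
  shows "rev (phi_tilde w) ! (turn i + x) = run_walk w i ! x"
  unfolding rev_phi_tilde using nth_concat_upt[of i _ x "run_walk w"] assms by simp

definition run_vertex :: "nat \<Rightarrow> nat \<Rightarrow> nat" where
  "run_vertex i x = (if w ! i < w ! (Suc i mod length w) then w ! i + x else w ! i - x)"

lemma syllable_ends:
  assumes "i < length w" "x < length (run_walk w i)"
  shows "syllable_start (Lambda_quiver n) (run_walk w i ! x) = run_vertex i x"
    and "syllable_end (Lambda_quiver n) (run_walk w i ! x) = run_vertex i (Suc x)"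
  using nth_run_walk[OF assms(2)] length_run_walk[of w i] assms(2)
  unfolding run_vertex_def by (auto simp: Lambda_quiver_def)

lemma run_vertex_end: "run_vertex i (length (run_walk w i)) = w ! (Suc i mod length w)"
  using length_run_walk[of w i] unfolding run_vertex_def by auto

lemma walk_vertex_0: "walk_vertex (Lambda_quiver 0) (phi_tilde w) 0 = w ! 0"
  using nth_walk[of 0 0] syllable_ends(1)[of 0 0] run_walk_nonempty[of 0] length_w
  by (simp add: walk_vertex_def run_vertex_def)

text \<open>For positive \<open>x\<close> the point is the end of a syllable of run
  \<open>i\<close>. The reduction modulo \<open>L\<close> takes effect only at the end of the last
  run, where the walk is back at its start.\<close>

lemma walk_vertex_run_pos:
  assumes "i < length w" "0 < x" "x \<le> length (run_walk w i)"
  shows "walk_vertex (Lambda_quiver 0) (phi_tilde w) ((turn i + x) mod L) = run_vertex i x"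
proof (cases "turn i + x = L")
  case True
  have "Suc i = length w"
  proof (rule ccontr)
    assume "Suc i \<noteq> length w"
    then show False
      using turn_Suc_le[of "Suc i"] run_walk_nonempty[of "Suc i"] assms True
      by (simp del: length_greater_0_conv)
  qed
  moreover have "x = length (run_walk w i)" using turn_Suc_le[of i] assms True by simp
  ultimately show ?thesis using True run_vertex_end[of i] walk_vertex_0 by simp
next
  case False
  then have "turn i + x < L" using turn_Suc_le[of i] assms by simp
  then show ?thesis
    using nth_walk[of i "x - 1"] syllable_ends(2)[of i "x - 1"] assms
    by (simp add: walk_vertex_def)
qed

lemma walk_vertex_run:
  assumes "i < length w" "x \<le> length (run_walk w i)"
  shows "walk_vertex (Lambda_quiver 0) (phi_tilde w) ((turn i + x) mod L) = run_vertex i x"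
proof (cases "x = 0")
  case False
  then show ?thesis using walk_vertex_run_pos assms by simp
next
  \<comment> \<open>The start of a run is handled as the end of the preceding one, or as the start
    of the walk.\<close>
  case True
  show ?thesis
  proof (cases i)
    case 0
    then show ?thesis using True walk_vertex_0 by (simp add: run_vertex_def)
  next
    case (Suc m)
    then have "walk_vertex (Lambda_quiver 0) (phi_tilde w) (turn i mod L) = w ! i"
      using walk_vertex_run_pos[of m "length (run_walk w m)"] run_walk_nonempty[of m] run_vertex_end[of m] assms
      by simp
    then show ?thesis using True by (simp add: run_vertex_def)
  qed
qed

lemma height_periodic: "u (x + m * int L) = u x"
  unfolding height_def by simp

lemma height_mod: "u (x mod int L) = u x"
  unfolding height_def by simp

lemma height_run:
  fixes i x :: int
  assumes "0 \<le> x" "x \<le> \<bar>h (i + 1) - h i\<bar>"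
  shows "u (turn_index w i + x) = (if h i < h (i + 1) then h i + x else h i - x)"
proof -
  let ?i = "nat (i mod int (length w))"
  have i: "?i < length w" using length_w by (simp add: nat_less_iff)
  have hi: "h i = int (w ! ?i)" "h (i + 1) = int (w ! (Suc ?i mod length w))"
    using letter_Suc length_w by (auto simp: letter_def)
  have x: "nat x \<le> length (run_walk w ?i)"
    using assms hi length_run_walk[of w ?i] by linarith
  have "(turn_index w i + x) mod int L = int ((turn ?i + nat x) mod L)"
  proof -
    have "turn_index w i + x = int (turn ?i + nat x) + i div int (length w) * int L"
      unfolding turn_index_def using assms(1) by simp
    then show ?thesis by (simp only: mod_mult_self1 zmod_int)
  qed
  then have "u (turn_index w i + x) = int (run_vertex ?i (nat x))"
    unfolding height_def using walk_vertex_run[OF i x] by simp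
  then show ?thesis
    unfolding run_vertex_def using hi assms by auto
qed

lemma turn_index_Suc: "turn_index w (i + 1) = turn_index w i + \<bar>h (i + 1) - h i\<bar>"
proof -
  let ?k = "int (length w)"
  let ?i = "nat (i mod ?k)"
  have k: "?k > 0" using length_w by simp
  have i: "?i < length w" using k by (simp add: nat_less_iff)
  have len: "int (length (run_walk w ?i)) = \<bar>h (i + 1) - h i\<bar>"
    using length_run_walk[of w ?i] letter_Suc[of w i] length_w by (simp add: letter_def)
  show ?thesis
  proof (cases "Suc ?i = length w")
    case True
    moreover have "0 \<le> i mod ?k" using k by simp
    ultimately have last: "i mod ?k = ?k - 1" by linarith
    then have "(i + 1) mod ?k = 0" "(i + 1) div ?k = i div ?k + 1"
      using k last div_mult_mod_eq[of i ?k]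
      by (intro int_mod_pos_eq[where q = "i div ?k + 1"] int_div_pos_eq[where r = 0]; simp add: algebra_simps)+
    moreover have "turn ?i + length (run_walk w ?i) = L"
      using True turn_length by (metis sum.lessThan_Suc)
    then have "int L = int (turn ?i) + int (length (run_walk w ?i))" by linarith
    ultimately show ?thesis unfolding turn_index_def len[symmetric]
      by (simp add: distrib_right del: int_ops of_nat_sum)
  next
    case False
    then have lt: "i mod ?k + 1 < ?k" "0 \<le> i mod ?k" using i k by auto
    then have "(i + 1) mod ?k = i mod ?k + 1" "(i + 1) div ?k = i div ?k"
      by (intro int_mod_pos_eq[where q = "i div ?k"] int_div_pos_eq[where r = "i mod ?k + 1"]; simp)+
    moreover have "nat (i mod ?k + 1) = Suc ?i" using lt by simp
    ultimately show ?thesis unfolding turn_index_def len[symmetric] by simp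
  qed
qed

sublocale zigzag_walk h "turn_index w" u
proof
  show "h i \<noteq> h (i + 1)" for i by (rule letter_neq)
  show "h i < h (i + 1) \<longleftrightarrow> h (i + 2) < h (i + 1)" for i by (rule letter_alt)
  show "turn_index w (i + 1) = turn_index w i + \<bar>h (i + 1) - h i\<bar>" for i by (rule turn_index_Suc)
  show "u (turn_index w i + x) = h i + x" if "h i < h (i + 1)" "0 \<le> x" "x \<le> h (i + 1) - h i" for i x
    using height_run[of x i] that by simp
  show "u (turn_index w i + x) = h i - x" if "h (i + 1) < h i" "0 \<le> x" "x \<le> h i - h (i + 1)" for i x
    using height_run[of x i] that by simp
qed

lemma weakly_perfectly_clustering_iff: "weakly_perfectly_clustering w \<longleftrightarrow> \<not> pinch u"
  unfolding weakly_perfectly_clustering_def pinch_walk_iff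
    pinch_letter_iff[OF length_w(2)] crossing_letter_iff[OF length_w(1) letter_neq] by simp

text \<open>An arrow carries the number of its lower vertex, which is the start of an ascent and the
  end of a descent. Equal steps of two translates thus use the same arrow in the same direction, and
  from here on the band can be replaced by \<open>u\<close>.\<close>

lemma nth_walk_height:
  assumes "j < L"
  shows "rev (phi_tilde w) ! j = (if u (int j + 1) = u (int j) + 1 then Inverse (ArrowB (nat (u (int j))))
     else Direct (ArrowA (nat (u (int j + 1)))))"
proof -
  obtain i x where ix: "i < length w" "x < length (run_walk w i)" "j = turn i + x"
    using index_in_sum[of j "\<lambda>j. length (run_walk w j)" "length w"] assms length_phi_tilde by auto
  have "int j mod int L = int ((turn i + x) mod L)" "(int j + 1) mod int L = int ((turn i + Suc x) mod L)"
    using ix(3) by (simp_all add: zmod_int algebra_simps)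
  then have "u (int j) = int (run_vertex i x)" "u (int j + 1) = int (run_vertex i (Suc x))"
    unfolding height_def using walk_vertex_run[of i x] walk_vertex_run[of i "Suc x"] ix by simp_all
  then show ?thesis
    using nth_walk[OF ix(1,2)] nth_run_walk[OF ix(2)] ix length_run_walk[of w i]
    unfolding run_vertex_def by auto
qed

lemma height_between: "\<exists>a\<in>set w. \<exists>b\<in>set w. int a \<le> u x \<and> u x \<le> int b"
proof -
  have *: "\<exists>a\<in>set w. h i = int a" for i
    using length_w by (intro bexI[of _ "w ! nat (i mod int (length w))"]) (auto simp: letter_def nat_less_iff)
  obtain i where i: "turn_index w i \<le> x" "x < turn_index w (i + 1)" using run_containing by blast
  consider "h i < h (i + 1)" | "h (i + 1) < h i" using neq[of i] by linarith
  then have "h i \<le> u x \<and> u x \<le> h (i + 1) \<or> h (i + 1) \<le> u x \<and> u x \<le> h i"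
    using u_up'[of i x] u_down'[of i x] P_step[of i] i by cases auto
  then show ?thesis using *[of i] *[of "i + 1"] by metis
qed

text \<open>Agreement with the translate by \<open>d\<close> on a half-line extends to all integers
  by periodicity. The translation then permutes the turning points, hence shifts the letters, and
  the corresponding rotation fixes the word; primitivity makes it trivial, and \<open>d\<close> a
  multiple of \<open>L\<close>.\<close>

lemma aperiodic:
  assumes prim: "primitive_word w" and d: "\<not> int L dvd d"
  shows "\<exists>x\<ge>y. u (x + d) \<noteq> u x"
proof (rule ccontr)
  assume "\<not> ?thesis"
  then have ge: "u (x + d) = u x" if "x \<ge> y" for x using that by blast
  have all: "u (x + d) = u x" for x
  proof -
    \<comment> \<open>Since \<open>L\<close> is at least 1, this many periods carry any
      \<open>x\<close> beyond \<open>y\<close>.\<close>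
    have "\<bar>y\<bar> + \<bar>x\<bar> \<le> (\<bar>y\<bar> + \<bar>x\<bar>) * int L" using L_pos by (intro mult_le_cancel_left1[THEN iffD2]) (auto simp del: length_greater_0_conv)
    then have "y \<le> x + (\<bar>y\<bar> + \<bar>x\<bar>) * int L" by linarith
    from ge[OF this] show ?thesis
      using height_periodic[of x "\<bar>y\<bar> + \<bar>x\<bar>"] height_periodic[of "x + d" "\<bar>y\<bar> + \<bar>x\<bar>"]
      by (simp add: add.assoc add.commute[of d])
  qed
  have P0: "turn_index w 0 = 0" unfolding turn_index_def by simp
  \<comment> \<open>Position 0 is a turning point, so its translate \<open>d\<close> is one
    too.\<close>
  have "u (d + 1) = u (d - 1)"
    using turning_P[of 0] all[of 1] all[of "-1"] by (simp add: P0 add.commute)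
  then obtain a where a: "d = turn_index w a" using turning_point by blast
  have step: "h (a + int n) = h (int n) \<and> turn_index w (a + int n) = turn_index w (int n) + d" for n
  proof (induction n)
    case 0
    then show ?case using u_P[of a] u_P[of 0] all[of 0] by (simp add: P0 a)
  next
    case (Suc n)
    let ?n = "int n" and ?m = "a + int n"
    have shift: "u (turn_index w ?m + x) = u (turn_index w ?n + x)" for x
      using all[of "turn_index w ?n + x"] Suc.IH by (simp add: algebra_simps)
    \<comment> \<open>If the next letters differed, \<open>diverge\<close> would produce a
      difference of the two walks, in one order or the other.\<close>
    have "h (?m + 1) = h (?n + 1)"
      using diverge[of ?m ?n] diverge[of ?n ?m] Suc.IH shift
      by (metis less_irrefl linorder_neqE_linordered_idom)
    then show ?case using P_step[of ?m] P_step[of ?n] Suc.IH by (simp add: add.assoc add.commute[of 1])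
  qed
  let ?a = "nat (a mod int (length w))"
  have "rotate ?a w = w"
  proof (rule nth_equalityI)
    fix n assume "n < length (rotate ?a w)"
    then show "rotate ?a w ! n = w ! n"
      using rotate_nth_letter[of n w a] step[of n] letter_of_nat[of n w] by simp
  qed simp
  moreover have "?a < length w" using length_w by (simp add: nat_less_iff)
  ultimately have "?a = 0" using rotate_fixed_not_primitive prim by blast
  then have "d = a div int (length w) * int L" unfolding a turn_index_def by simp
  then show False using d by simp
qed

end

section \<open>Endomorphisms of band modules\<close>

text \<open>Entries are addressed by positions on the walk instead of row and column numbers, so
  that matrix products become sums over positions.\<close>

definition index_mat :: "'a list \<Rightarrow> 'b list \<Rightarrow> ('a \<Rightarrow> 'b \<Rightarrow> 'k) \<Rightarrow> 'k mat" where
  "index_mat P S F = mat (length P) (length S) (\<lambda>(r, c). F (P ! r) (S ! c))"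

lemma index_mat_carrier [simp]: "index_mat P S F \<in> carrier_mat (length P) (length S)"
  unfolding index_mat_def by simp

lemma sum_nth_distinct:
  assumes "distinct S"
  shows "(\<Sum>i<length S. g (S ! i)) = sum g (set S)"
  using sum.reindex_bij_betw[OF bij_betw_nth[OF assms refl refl], of g] .

lemma index_mat_mult:
  fixes F :: "'a \<Rightarrow> 'b \<Rightarrow> 'k :: comm_ring_1"
  assumes "distinct S"
  shows "index_mat P S F * index_mat S T H = index_mat P T (\<lambda>t s. \<Sum>y\<in>set S. F t y * H y s)"
proof (rule eq_matI)
  fix i j assume "i < dim_row (index_mat P T (\<lambda>t s. \<Sum>y\<in>set S. F t y * H y s))"
    "j < dim_col (index_mat P T (\<lambda>t s. \<Sum>y\<in>set S. F t y * H y s))"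
  then have "i < length P" "j < length T" unfolding index_mat_def by auto
  then show "(index_mat P S F * index_mat S T H) $$ (i, j) =
      index_mat P T (\<lambda>t s. \<Sum>y\<in>set S. F t y * H y s) $$ (i, j)"
    using sum_nth_distinct[OF assms, of "\<lambda>y. F (P ! i) y * H y (T ! j)"]
    unfolding index_mat_def by (simp add: scalar_prod_def atLeast0LessThan)
qed (auto simp: index_mat_def)

lemma index_mat_eq_iff:
  "index_mat P S F = index_mat P S G \<longleftrightarrow> (\<forall>t\<in>set P. \<forall>s\<in>set S. F t s = G t s)"
proof
  assume eq: "index_mat P S F = index_mat P S G"
  show "\<forall>t\<in>set P. \<forall>s\<in>set S. F t s = G t s"
  proof (intro ballI)
    fix t s assume "t \<in> set P" "s \<in> set S"
    then obtain i j where "i < length P" "t = P ! i" "j < length S" "s = S ! j"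
      by (metis in_set_conv_nth)
    then show "F t s = G t s"
      using arg_cong[OF eq, of "\<lambda>M. M $$ (i, j)"] unfolding index_mat_def by simp
  qed
next
  assume "\<forall>t\<in>set P. \<forall>s\<in>set S. F t s = G t s"
  then show "index_mat P S F = index_mat P S G"
    unfolding index_mat_def by (intro eq_matI) auto
qed

lemma ex_index_mat:
  assumes M: "M \<in> carrier_mat (length P) (length S)" and "distinct P" "distinct S"
  shows "\<exists>F. M = index_mat P S F"
proof -
  let ?F = "\<lambda>t s. M $$ (the_inv_into {..<length P} ((!) P) t, the_inv_into {..<length S} ((!) S) s)"
  have "inj_on ((!) P) {..<length P}" "inj_on ((!) S) {..<length S}"
    using assms by (simp_all add: inj_on_nth)
  then have "M = index_mat P S ?F"
    using M unfolding index_mat_def by (intro eq_matI) (auto simp: the_inv_into_f_f)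
  then show ?thesis by blast
qed

lemma one_mat_index_mat:
  assumes "distinct P"
  shows "(c :: 'k :: semiring_1) \<cdot>\<^sub>m 1\<^sub>m (length P) = index_mat P P (\<lambda>t s. if t = s then c else 0)"
  using assms unfolding index_mat_def by (intro eq_matI) (auto simp: nth_eq_iff_index_eq)

lemma zero_mat_index_mat: "0\<^sub>m (length P) (length S) = index_mat P S (\<lambda>_ _. 0)"
  unfolding index_mat_def by (intro eq_matI) auto

section \<open>Scalar endomorphisms and bricks\<close>

definition scalar_endo :: "('v, 'e) pre_digraph \<Rightarrow> ('v, 'e, 'k :: field) quiver_rep \<Rightarrow> 'k \<Rightarrow> 'v \<Rightarrow> 'k mat" where
  "scalar_endo Q M c = (\<lambda>v\<in>verts Q. c \<cdot>\<^sub>m 1\<^sub>m (rep_dim M v))"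

lemma scalar_endo_in_endomorphisms:
  assumes "is_module Q \<rho> M" "\<And>e. e \<in> arcs Q \<Longrightarrow> head Q e \<in> verts Q \<and> tail Q e \<in> verts Q"
  shows "scalar_endo Q M c \<in> endomorphisms Q M"
proof -
  have "scalar_endo Q M c (head Q e) * rep_map M e = rep_map M e * scalar_endo Q M c (tail Q e)"
    if e: "e \<in> arcs Q" for e
  proof -
    let ?A = "rep_map M e"
    have A: "?A \<in> carrier_mat (rep_dim M (head Q e)) (rep_dim M (tail Q e))"
      using assms(1) e unfolding is_module_def by blast
    then have "(c \<cdot>\<^sub>m 1\<^sub>m (rep_dim M (head Q e))) * ?A = ?A * (c \<cdot>\<^sub>m 1\<^sub>m (rep_dim M (tail Q e)))"
      using mult_smult_assoc_mat[OF one_carrier_mat A] mult_smult_distrib[OF A one_carrier_mat] by simp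
    then show ?thesis using assms(2)[OF e] unfolding scalar_endo_def by simp
  qed
  then show ?thesis unfolding endomorphisms_def scalar_endo_def by auto
qed

text \<open>Linearity gives \<open>\<phi> c = c \<phi> 1\<close>, so the isomorphism required by
  \<open>brick\<close> can only be the map sending a scalar to its multiple of the identity. A
  vertex with nonzero space makes that map injective; what remains is its surjectivity.\<close>

lemma brick_iff:
  assumes "is_module Q \<rho> M" "\<And>e. e \<in> arcs Q \<Longrightarrow> head Q e \<in> verts Q \<and> tail Q e \<in> verts Q"
    and v: "v \<in> verts Q" "rep_dim M v > 0"
  shows "brick Q \<rho> M \<longleftrightarrow> (\<forall>f\<in>endomorphisms Q M. \<exists>c. f = scalar_endo Q M c)"
proof
  assume "brick Q \<rho> M"
  then obtain \<phi> where \<phi>: "bij_betw \<phi> UNIV (endomorphisms Q M)"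
    "\<phi> 1 = (\<lambda>v\<in>verts Q. 1\<^sub>m (rep_dim M v))" "\<And>c x. \<phi> (c * x) = (\<lambda>v\<in>verts Q. c \<cdot>\<^sub>m \<phi> x v)"
    unfolding brick_def by auto
  have "\<phi> c = scalar_endo Q M c" for c
    using \<phi>(2) \<phi>(3)[of c 1] unfolding scalar_endo_def by (auto intro!: restrict_ext)
  then have "\<phi> = scalar_endo Q M" by auto
  then show "\<forall>f\<in>endomorphisms Q M. \<exists>c. f = scalar_endo Q M c"
    using \<phi>(1) unfolding bij_betw_def by blast
next
  assume all: "\<forall>f\<in>endomorphisms Q M. \<exists>c. f = scalar_endo Q M c"
  let ?\<phi> = "scalar_endo Q M"
  have "inj ?\<phi>"
  proof (rule injI)
    fix c d assume "?\<phi> c = ?\<phi> d"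
    then have "?\<phi> c v $$ (0, 0) = ?\<phi> d v $$ (0, 0)" by simp
    then show "c = d" using v unfolding scalar_endo_def by simp
  qed
  moreover have "range ?\<phi> = endomorphisms Q M"
    using scalar_endo_in_endomorphisms[OF assms(1,2)] all by blast
  ultimately have "bij_betw ?\<phi> UNIV (endomorphisms Q M)" unfolding bij_betw_def by simp
  moreover have "?\<phi> (x + y) = (\<lambda>v\<in>verts Q. ?\<phi> x v + ?\<phi> y v)" for x y
    unfolding scalar_endo_def by (auto intro!: restrict_ext eq_matI)
  moreover have "?\<phi> (x * y) = (\<lambda>v\<in>verts Q. ?\<phi> x v * ?\<phi> y v)" for x y
    unfolding scalar_endo_def
  proof (intro restrict_ext)
    fix v assume "v \<in> verts Q"
    then show "x * y \<cdot>\<^sub>m 1\<^sub>m (rep_dim M v) = (\<lambda>v\<in>verts Q. x \<cdot>\<^sub>m 1\<^sub>m (rep_dim M v)) v * (\<lambda>v\<in>verts Q. y \<cdot>\<^sub>m 1\<^sub>m (rep_dim M v)) v"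
      by (simp add: mult_smult_assoc_mat[of _ "rep_dim M v" "rep_dim M v"])
         (auto intro!: eq_matI)
  qed
  moreover have "?\<phi> 1 = (\<lambda>v\<in>verts Q. 1\<^sub>m (rep_dim M v))"
    unfolding scalar_endo_def by (auto intro!: restrict_ext eq_matI)
  moreover have "?\<phi> (c * x) = (\<lambda>v\<in>verts Q. c \<cdot>\<^sub>m ?\<phi> x v)" for c x
    unfolding scalar_endo_def by (auto intro!: restrict_ext eq_matI)
  ultimately show "brick Q \<rho> M" unfolding brick_def using assms(1) by blast
qed

section \<open>Matrix entries of the band module\<close>

lemma band_module_rep_dim: "rep_dim (band_module Q b p 1 lam) v = length (positions_at Q b v)"
  unfolding band_module_def by simp

text \<open>The only entry of \<open>band_block\<close> for \<open>l = 1\<close>, where the Jordan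
  block is just \<open>lam\<close>.\<close>

definition band_coeff :: "'e syllable list \<Rightarrow> nat \<Rightarrow> 'k :: field \<Rightarrow> 'e \<Rightarrow> nat \<Rightarrow> nat \<Rightarrow> 'k" where
  "band_coeff b p lam e t s = (\<Sum>j<length b.
       if (rev b ! j = Direct e \<and> s = j \<and> t = Suc j mod length b) \<or>
          (rev b ! j = Inverse e \<and> s = Suc j mod length b \<and> t = j)
       then (if j = p then lam else 1) else 0)"

lemma band_module_rep_map:
  "rep_map (band_module Q b p 1 lam) e =
     index_mat (positions_at Q b (head Q e)) (positions_at Q b (tail Q e)) (band_coeff b p lam e)"
proof -
  have "band_block b p 1 lam e t s $$ (0, 0) = band_coeff b p lam e t s" for t s
    unfolding band_block_def band_coeff_def by (auto simp: jordan_block_def intro!: sum.cong)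
  then show ?thesis unfolding band_module_def index_mat_def by (simp add: Let_def)
qed

context crown_word
begin

abbreviation "pos n v \<equiv> positions_at (Lambda_quiver n) (phi_tilde w) v"

text \<open>Walks are followed on the integers, whereas matrix entries are indexed by residues
  modulo \<open>L\<close>.\<close>

definition red :: "int \<Rightarrow> nat" where
  "red x = nat (x mod int L)"

lemma int_red: "int (red x) = x mod int L"
  using L_pos unfolding red_def by simp

lemma red_less: "red x < L"
  using L_pos unfolding red_def by (simp add: nat_less_iff)

lemma red_of_nat: "j < L \<Longrightarrow> red (int j) = j"
  unfolding red_def by simp

lemma height_red: "u (int (red x)) = u x"
  by (simp add: int_red height_mod)

lemma red_eq_iff: "red x = red y \<longleftrightarrow> int L dvd x - y"
  using int_red[of x] int_red[of y] by (metis mod_eq_dvd_iff of_nat_eq_iff)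

lemma red_shift: "red x = red y \<Longrightarrow> red (x + d) = red (y + d)"
  unfolding red_eq_iff by simp

lemma set_positions: "set (pos n v) = {j. j < L \<and> u (int j) = int v}"
  unfolding positions_at_def height_def
  by (auto simp: walk_vertex_Lambda[of n])

lemma distinct_positions: "distinct (pos n v)"
  unfolding positions_at_def by simp

lemma red_in_positions: "red x \<in> set (pos n v) \<longleftrightarrow> u x = int v"
  unfolding set_positions using red_less height_red by auto

text \<open>An a-arrow is only traversed forwards, so only step \<open>s\<close> can contribute to
  column \<open>s\<close>; in \<open>band_coeff_B\<close> it is step \<open>t\<close> and row
  \<open>t\<close>, as b-arrows are only traversed backwards.\<close>

lemma band_coeff_A:
  assumes "s < L"
  shows "band_coeff (phi_tilde w) p lam (ArrowA i) t s =
    (if rev (phi_tilde w) ! s = Direct (ArrowA i) \<and> t = Suc s mod L then if s = p then lam else 1 else 0)"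
proof -
  have "rev (phi_tilde w) ! j \<noteq> Inverse (ArrowA i)" if "j < L" for j
    using nth_walk_height[OF that] by simp
  then have "band_coeff (phi_tilde w) p lam (ArrowA i) t s =
    (\<Sum>j<L. if j = s then if rev (phi_tilde w) ! s = Direct (ArrowA i) \<and> t = Suc s mod L
       then if s = p then lam else 1 else 0 else 0)"
    unfolding band_coeff_def by (intro sum.cong) auto
  then show ?thesis using assms by simp
qed

lemma band_coeff_B:
  assumes "t < L"
  shows "band_coeff (phi_tilde w) p lam (ArrowB i) t s =
    (if rev (phi_tilde w) ! t = Inverse (ArrowB i) \<and> s = Suc t mod L then if t = p then lam else 1 else 0)"
proof -
  have "rev (phi_tilde w) ! j \<noteq> Direct (ArrowB i)" if "j < L" for j
    using nth_walk_height[OF that] by simp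
  then have "band_coeff (phi_tilde w) p lam (ArrowB i) t s =
    (\<Sum>j<L. if j = t then if rev (phi_tilde w) ! t = Inverse (ArrowB i) \<and> s = Suc t mod L
       then if t = p then lam else 1 else 0 else 0)"
    unfolding band_coeff_def by (intro sum.cong) auto
  then show ?thesis using assms by simp
qed

lemma Suc_mod_red: "j < L \<Longrightarrow> Suc j mod L = red (int j + 1)"
  unfolding red_def using L_pos by (simp add: nat_mod_distrib nat_add_distrib)

lemma red_Suc_eq_iff: "red x = red (y + 1) \<longleftrightarrow> red y = red (x - 1)"
  unfolding red_eq_iff by (metis dvd_minus_iff minus_diff_eq diff_diff_eq2 diff_diff_eq add.commute)

lemma band_coeff_A':
  assumes "s < L" "u (int s) = int i + 1" "t < L" "u (int t) = int i"
  shows "band_coeff (phi_tilde w) p lam (ArrowA i) t s =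
    (if t = red (int s + 1) then if s = p then lam else 1 else 0)"
  using nth_walk_height[OF assms(1)] assms height_red[of "int s + 1"]
  by (auto simp: band_coeff_A Suc_mod_red)

lemma band_coeff_B':
  assumes "s < L" "u (int s) = int i + 1" "t < L" "u (int t) = int i"
  shows "band_coeff (phi_tilde w) p lam (ArrowB i) t s =
    (if s = red (int t + 1) then if t = p then lam else 1 else 0)"
  using nth_walk_height[OF assms(3)] assms height_red[of "int t + 1"]
  by (auto simp: band_coeff_B Suc_mod_red)

end

text \<open>The block of the band module carrying \<open>lam\<close> is at an arbitrary position \<open>p\<close>, which enters only
  through the nonzero weights of the steps of the walk.\<close>
locale crown_band = crown_word "{1..N}" w for N :: nat and w :: "nat list" +
  fixes p :: nat and lam :: "'k :: field"
  assumes lam_nonzero: "lam \<noteq> 0"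
begin

abbreviation "Q \<equiv> Lambda_quiver N"
abbreviation "M \<equiv> band_module Q (phi_tilde w) p 1 lam"
abbreviation "bcoeff \<equiv> band_coeff (phi_tilde w) p lam"

text \<open>The scalar on the step from \<open>x\<close> to \<open>x + 1\<close>.\<close>

definition weight :: "int \<Rightarrow> 'k" where
  "weight x = (if red x = p then lam else 1)"

lemma weight_nonzero: "weight x \<noteq> 0"
  using lam_nonzero unfolding weight_def by simp

lemma height_range: "1 \<le> u x" "u x \<le> int N"
proof -
  obtain a b where "a \<in> set w" "b \<in> set w" "int a \<le> u x" "u x \<le> int b"
    using height_between by blast
  moreover have "set w \<subseteq> {1..N}" using crown unfolding crown_def by blast
  ultimately show "1 \<le> u x" "u x \<le> int N" by fastforce+
qed

lemma arcs_ends: "e \<in> arcs Q \<Longrightarrow> head Q e \<in> verts Q \<and> tail Q e \<in> verts Q"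
  unfolding Lambda_quiver_def by auto

text \<open>A nonzero term in a product of an a-arrow and a b-arrow would need one and the same step
  to be both direct and inverse: the step out of \<open>y\<close> for the product \<open>A\<close>,
  the step into \<open>y\<close> for the product \<open>B\<close>.\<close>

lemma is_module_band: "is_module Q (Lambda_relations N) M"
proof -
  have A: "bcoeff (ArrowA i) t y * bcoeff (ArrowB (Suc i)) y s = 0" if "y < L" for i t y s
    using that by (simp add: band_coeff_A band_coeff_B)
  have B: "bcoeff (ArrowB i) t y * bcoeff (ArrowA (Suc i)) y s = 0" if "t < L" "s < L" for i t y s
  proof -
    have inj: "Suc t mod L = Suc s mod L \<Longrightarrow> t = s"
      using that red_Suc_eq_iff[of "int t + 1" "int s"] by (simp add: Suc_mod_red red_of_nat)
    show ?thesis
    proof (rule ccontr)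
      assume "\<not> ?thesis"
      then have "bcoeff (ArrowB i) t y \<noteq> 0" "bcoeff (ArrowA (Suc i)) y s \<noteq> 0" by auto
      then have "rev (phi_tilde w) ! t = Inverse (ArrowB i)" "rev (phi_tilde w) ! s = Direct (ArrowA (Suc i))"
        "y = Suc t mod L" "y = Suc s mod L"
        unfolding band_coeff_A[OF that(2)] band_coeff_B[OF that(1)] by (metis (full_types))+
      then show False using inj by simp
    qed
  qed
  have ends: "head Q e = arrow_index e" "tail Q e = arrow_index e + 1" for e
    by (simp_all add: Lambda_quiver_def)
  show ?thesis
    unfolding is_module_def band_module_rep_map band_module_rep_dim Lambda_relations_def
    by (auto simp: ends index_mat_mult[OF distinct_positions] zero_mat_index_mat index_mat_eq_iff
        set_positions A B intro!: sum.neutral)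
qed

definition index_endo :: "(nat \<Rightarrow> nat \<Rightarrow> 'k) \<Rightarrow> nat \<Rightarrow> 'k mat" where
  "index_endo F = (\<lambda>v\<in>verts Q. index_mat (pos N v) (pos N v) F)"

lemma endomorphism_index_endo:
  assumes "f \<in> endomorphisms Q M"
  shows "\<exists>F. f = index_endo F"
proof -
  have f: "f \<in> (\<Pi>\<^sub>E v\<in>verts Q. carrier_mat (length (pos N v)) (length (pos N v)))"
    using assms unfolding endomorphisms_def band_module_rep_dim by blast
  then have "\<forall>v\<in>verts Q. \<exists>F. f v = index_mat (pos N v) (pos N v) F"
    using ex_index_mat[OF _ distinct_positions distinct_positions] PiE_mem[OF f] by blast
  then obtain F where F: "\<And>v. v \<in> verts Q \<Longrightarrow> f v = index_mat (pos N v) (pos N v) (F v)"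
    using bchoice[of "verts Q" "\<lambda>v F. f v = index_mat (pos N v) (pos N v) F"] by blast
  \<comment> \<open>Each position lies at exactly one vertex, so its height selects the component
    and one function on pairs serves all vertices.\<close>
  have "index_mat (pos N v) (pos N v) (F v) = index_mat (pos N v) (pos N v) (\<lambda>t s. F (nat (u (int t))) t s)" for v
    unfolding index_mat_eq_iff set_positions by simp
  then have "f v = index_endo (\<lambda>t s. F (nat (u (int t))) t s) v" for v
    using F[of v] f unfolding index_endo_def by (cases "v \<in> verts Q") auto
  then show ?thesis by blast
qed

section \<open>Commutation with the arrows, entry by entry\<close>

lemma red_int_red: "red (int (red x) + d) = red (x + d)"
  using red_shift[of "int (red x)" x d] by (simp add: red_of_nat red_less)

lemma sum_in_A:
  assumes "u s = int i + 1"
  shows "(\<Sum>x\<in>set (pos N i). F x * bcoeff (ArrowA i) x (red s)) =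
    (if u (s + 1) = int i then F (red (s + 1)) * weight s else 0)"
proof -
  have "(\<Sum>x\<in>set (pos N i). F x * bcoeff (ArrowA i) x (red s)) =
    (\<Sum>x\<in>set (pos N i). if x = red (s + 1) then F (red (s + 1)) * weight s else 0)"
    using assms
    by (intro sum.cong) (auto simp: set_positions band_coeff_A' red_less height_red red_int_red weight_def)
  then show ?thesis by (simp add: red_in_positions)
qed

lemma sum_out_A:
  assumes "u t = int i"
  shows "(\<Sum>y\<in>set (pos N (i + 1)). bcoeff (ArrowA i) (red t) y * F y) =
    (if u (t - 1) = int i + 1 then weight (t - 1) * F (red (t - 1)) else 0)"
proof -
  have "red t = red (int y + 1) \<longleftrightarrow> y = red (t - 1)" if "y < L" for y
    using red_Suc_eq_iff[of t "int y"] that by (simp add: red_of_nat)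
  then have "(\<Sum>y\<in>set (pos N (i + 1)). bcoeff (ArrowA i) (red t) y * F y) =
    (\<Sum>y\<in>set (pos N (i + 1)). if y = red (t - 1) then weight (t - 1) * F (red (t - 1)) else 0)"
    using assms
    by (intro sum.cong) (auto simp: set_positions band_coeff_A' red_less height_red weight_def)
  then show ?thesis by (simp add: red_in_positions add.commute del: of_nat_add of_nat_Suc flip: of_nat_Suc)
qed

lemma sum_in_B:
  assumes "u s = int i + 1"
  shows "(\<Sum>x\<in>set (pos N i). F x * bcoeff (ArrowB i) x (red s)) =
    (if u (s - 1) = int i then F (red (s - 1)) * weight (s - 1) else 0)"
proof -
  have "red s = red (int x + 1) \<longleftrightarrow> x = red (s - 1)" if "x < L" for x
    using red_Suc_eq_iff[of s "int x"] that by (simp add: red_of_nat)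
  then have "(\<Sum>x\<in>set (pos N i). F x * bcoeff (ArrowB i) x (red s)) =
    (\<Sum>x\<in>set (pos N i). if x = red (s - 1) then F (red (s - 1)) * weight (s - 1) else 0)"
    using assms
    by (intro sum.cong) (auto simp: set_positions band_coeff_B' red_less height_red weight_def)
  then show ?thesis by (simp add: red_in_positions)
qed

lemma sum_out_B:
  assumes "u t = int i"
  shows "(\<Sum>y\<in>set (pos N (i + 1)). bcoeff (ArrowB i) (red t) y * F y) =
    (if u (t + 1) = int i + 1 then weight t * F (red (t + 1)) else 0)"
proof -
  have "(\<Sum>y\<in>set (pos N (i + 1)). bcoeff (ArrowB i) (red t) y * F y) =
    (\<Sum>y\<in>set (pos N (i + 1)). if y = red (t + 1) then weight t * F (red (t + 1)) else 0)"
    using assms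
    by (intro sum.cong) (auto simp: set_positions band_coeff_B' red_less height_red red_int_red weight_def)
  then show ?thesis by (simp add: red_in_positions add.commute del: of_nat_add of_nat_Suc flip: of_nat_Suc)
qed

text \<open>The entry at row \<open>t\<close> and column \<open>s\<close> of the commutation with an
  a-arrow, for \<open>s\<close> one level above \<open>t\<close>. Each side has at most one term,
  and the two index pairs \<open>(t, s + 1)\<close> and \<open>(t - 1, s)\<close> differ by a
  simultaneous shift by one.\<close>

definition commutes_A :: "(nat \<Rightarrow> nat \<Rightarrow> 'k) \<Rightarrow> int \<Rightarrow> int \<Rightarrow> bool" where
  "commutes_A F t s \<longleftrightarrow> (if u (s + 1) = u t then F (red t) (red (s + 1)) * weight s else 0) =
     (if u (t - 1) = u s then weight (t - 1) * F (red (t - 1)) (red s) else 0)"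

definition commutes_B :: "(nat \<Rightarrow> nat \<Rightarrow> 'k) \<Rightarrow> int \<Rightarrow> int \<Rightarrow> bool" where
  "commutes_B F t s \<longleftrightarrow> (if u (s - 1) = u t then F (red t) (red (s - 1)) * weight (s - 1) else 0) =
     (if u (t + 1) = u s then weight t * F (red (t + 1)) (red s) else 0)"

lemma positions_all_iff: "(\<forall>t\<in>set (pos N v). R t) \<longleftrightarrow> (\<forall>t. u t = int v \<longrightarrow> R (red t))"
proof
  assume "\<forall>t. u t = int v \<longrightarrow> R (red t)"
  then show "\<forall>t\<in>set (pos N v). R t"
    unfolding set_positions by (metis (mono_tags, lifting) mem_Collect_eq red_of_nat)
qed (use red_in_positions in blast)

lemma index_mat_commutes_A:
  "index_mat (pos N i) (pos N i) F * index_mat (pos N i) (pos N (i + 1)) (bcoeff (ArrowA i)) =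
   index_mat (pos N i) (pos N (i + 1)) (bcoeff (ArrowA i)) * index_mat (pos N (i + 1)) (pos N (i + 1)) F \<longleftrightarrow>
   (\<forall>t s. u t = int i \<and> u s = int i + 1 \<longrightarrow> commutes_A F t s)"
proof -
  have "(\<Sum>y\<in>set (pos N i). F (red t) y * bcoeff (ArrowA i) y (red s)) =
      (\<Sum>y\<in>set (pos N (i + 1)). bcoeff (ArrowA i) (red t) y * F y (red s)) \<longleftrightarrow> commutes_A F t s"
    if "u t = int i" "u s = int i + 1" for t s
    unfolding sum_in_A[OF that(2)] sum_out_A[OF that(1)] commutes_A_def that ..
  then show ?thesis
    unfolding index_mat_mult[OF distinct_positions] index_mat_eq_iff positions_all_iff of_nat_add of_nat_1
    by blast
qed

lemma index_mat_commutes_B: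
  "index_mat (pos N i) (pos N i) F * index_mat (pos N i) (pos N (i + 1)) (bcoeff (ArrowB i)) =
   index_mat (pos N i) (pos N (i + 1)) (bcoeff (ArrowB i)) * index_mat (pos N (i + 1)) (pos N (i + 1)) F \<longleftrightarrow>
   (\<forall>t s. u t = int i \<and> u s = int i + 1 \<longrightarrow> commutes_B F t s)"
proof -
  have "(\<Sum>y\<in>set (pos N i). F (red t) y * bcoeff (ArrowB i) y (red s)) =
      (\<Sum>y\<in>set (pos N (i + 1)). bcoeff (ArrowB i) (red t) y * F y (red s)) \<longleftrightarrow> commutes_B F t s"
    if "u t = int i" "u s = int i + 1" for t s
    unfolding sum_in_B[OF that(2)] sum_out_B[OF that(1)] commutes_B_def that ..
  then show ?thesis
    unfolding index_mat_mult[OF distinct_positions] index_mat_eq_iff positions_all_iff of_nat_add of_nat_1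
    by blast
qed

lemma index_endo_iff_commutes:
  "index_endo F \<in> endomorphisms Q M \<longleftrightarrow> (\<forall>t s. u s = u t + 1 \<longrightarrow> commutes_A F t s \<and> commutes_B F t s)"
proof -
  have arcs: "arcs Q = ArrowA ` {1..N - 1} \<union> ArrowB ` {1..N - 1}"
    and ends: "head Q e = arrow_index e" "tail Q e = arrow_index e + 1"
    and verts: "v \<in> verts Q \<longleftrightarrow> 1 \<le> v \<and> v \<le> N" for e v
    by (auto simp: Lambda_quiver_def)
  have "index_endo F \<in> endomorphisms Q M \<longleftrightarrow> (\<forall>e\<in>arcs Q.
      index_endo F (head Q e) * rep_map M e = rep_map M e * index_endo F (tail Q e))"
    unfolding endomorphisms_def index_endo_def band_module_rep_dim by auto
  also have "\<dots> \<longleftrightarrow> (\<forall>i\<in>{1..N - 1}. \<forall>t s. u t = int i \<and> u s = int i + 1 \<longrightarrow> commutes_A F t s \<and> commutes_B F t s)"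
  proof -
    have "index_endo F v = index_mat (pos N v) (pos N v) F" if "1 \<le> v" "v \<le> N" for v
      using that unfolding index_endo_def by (simp add: verts)
    then have endo: "index_endo F i = index_mat (pos N i) (pos N i) F"
      "index_endo F (i + 1) = index_mat (pos N (i + 1)) (pos N (i + 1)) F" if "i \<in> {1..N - 1}" for i
      using that by auto
    have A: "index_endo F i * rep_map M (ArrowA i) = rep_map M (ArrowA i) * index_endo F (i + 1) \<longleftrightarrow>
        (\<forall>t s. u t = int i \<and> u s = int i + 1 \<longrightarrow> commutes_A F t s)" if "i \<in> {1..N - 1}" for i
      unfolding band_module_rep_map ends arrow_index.simps endo[OF that] by (rule index_mat_commutes_A)
    have B: "index_endo F i * rep_map M (ArrowB i) = rep_map M (ArrowB i) * index_endo F (i + 1) \<longleftrightarrow>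
        (\<forall>t s. u t = int i \<and> u s = int i + 1 \<longrightarrow> commutes_B F t s)" if "i \<in> {1..N - 1}" for i
      unfolding band_module_rep_map ends arrow_index.simps endo[OF that] by (rule index_mat_commutes_B)
    have "(\<forall>e\<in>arcs Q. index_endo F (head Q e) * rep_map M e = rep_map M e * index_endo F (tail Q e)) \<longleftrightarrow>
       (\<forall>i\<in>{1..N - 1}. \<forall>t s. u t = int i \<and> u s = int i + 1 \<longrightarrow> commutes_A F t s) \<and>
       (\<forall>i\<in>{1..N - 1}. \<forall>t s. u t = int i \<and> u s = int i + 1 \<longrightarrow> commutes_B F t s)"
      unfolding arcs ball_Un ball_simps(9) ends arrow_index.simps
      by (intro arg_cong2[where f = "(\<and>)"] ball_cong refl A B)
    then show ?thesis by blast
  qed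
  also have "\<dots> \<longleftrightarrow> (\<forall>t s. u s = u t + 1 \<longrightarrow> commutes_A F t s \<and> commutes_B F t s)"
  proof (intro iffI allI impI)
    fix t s assume all: "\<forall>i\<in>{1..N - 1}. \<forall>t s. u t = int i \<and> u s = int i + 1 \<longrightarrow> commutes_A F t s \<and> commutes_B F t s"
      and "u s = u t + 1"
    then have "nat (u t) \<in> {1..N - 1}" "u t = int (nat (u t))" "u s = int (nat (u t)) + 1"
      using height_range[of t] height_range[of s] by auto
    then show "commutes_A F t s \<and> commutes_B F t s" using all by blast
  qed auto
  finally show ?thesis .
qed

text \<open>The same equations, indexed by the pair of steps starting at \<open>x\<close> and
  \<open>y\<close>: \<open>commutes_A\<close> at \<open>(x + 1, y)\<close> and
  \<open>commutes_B\<close> at \<open>(x, y + 1)\<close>. Common steps carry an entry along with a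
  quotient of weights; an entry is killed where the row walk parts below the column walk.\<close>

definition transports :: "(nat \<Rightarrow> nat \<Rightarrow> 'k) \<Rightarrow> int \<Rightarrow> int \<Rightarrow> bool" where
  "transports F x y \<longleftrightarrow>
    (u x = u y \<and> u (x + 1) = u x - 1 \<and> u (y + 1) = u y - 1 \<longrightarrow>
       weight y * F (red (x + 1)) (red (y + 1)) = weight x * F (red x) (red y)) \<and>
    (u x = u y \<and> u (x + 1) = u x + 1 \<and> u (y + 1) = u y + 1 \<longrightarrow>
       weight y * F (red x) (red y) = weight x * F (red (x + 1)) (red (y + 1))) \<and>
    (u x = u y \<and> u (x + 1) < u (y + 1) \<longrightarrow> F (red x) (red y) = 0) \<and>
    (u (x + 1) = u (y + 1) \<and> u x < u y \<longrightarrow> F (red (x + 1)) (red (y + 1)) = 0)"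

lemma commutes_iff_transports:
  "(\<forall>t s. u s = u t + 1 \<longrightarrow> commutes_A F t s \<and> commutes_B F t s) \<longleftrightarrow> (\<forall>x y. transports F x y)"
proof (intro iffI allI impI)
  fix x y assume *: "\<forall>t s. u s = u t + 1 \<longrightarrow> commutes_A F t s \<and> commutes_B F t s"
  have A: "commutes_A F (x + 1) y" if "u y = u (x + 1) + 1" using * that by blast
  have B: "commutes_B F x (y + 1)" if "u (y + 1) = u x + 1" using * that by blast
  show "transports F x y"
    unfolding transports_def
    using A B u_step[of x] u_step[of y] weight_nonzero
    by (auto simp: commutes_A_def commutes_B_def mult.commute)
next
  fix t s assume *: "\<forall>x y. transports F x y" and ts: "u s = u t + 1"
  have "commutes_A F t s"
  proof -
    have T: "transports F (t - 1) s" using * by blast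
    consider "u (t - 1) = u s" "u (s + 1) = u t" | "u (t - 1) = u s" "u (s + 1) = u t + 2"
      | "u (t - 1) = u t - 1" "u (s + 1) = u t" | "u (t - 1) = u t - 1" "u (s + 1) = u t + 2"
      using ts u_step[of "t - 1"] u_step[of s] by force
    then show ?thesis
      using T ts unfolding transports_def commutes_A_def by cases (simp_all add: mult.commute)
  qed
  moreover have "commutes_B F t s"
  proof -
    have T: "transports F t (s - 1)" using * by blast
    consider "u (t + 1) = u s" "u (s - 1) = u t" | "u (t + 1) = u s" "u (s - 1) = u t + 2"
      | "u (t + 1) = u t - 1" "u (s - 1) = u t" | "u (t + 1) = u t - 1" "u (s - 1) = u t + 2"
      using ts u_step[of t] u_step[of "s - 1"] by force
    then show ?thesis
      using T ts unfolding transports_def commutes_B_def by cases (simp_all add: mult.commute)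
  qed
  ultimately show "commutes_A F t s \<and> commutes_B F t s" ..
qed

lemma index_endo_iff: "index_endo F \<in> endomorphisms Q M \<longleftrightarrow> (\<forall>x y. transports F x y)"
  unfolding index_endo_iff_commutes commutes_iff_transports ..

end

section \<open>The fate of a single entry of an endomorphism\<close>

context crown_band
begin

lemma red_height_cong: "red x = red y \<Longrightarrow> u (x + d) = u (y + d)"
  using red_shift[of x y d] height_red by metis

lemma red_height_eq: "red x = red y \<Longrightarrow> u x = u y"
  using red_height_cong[of x y 0] by simp

lemma weight_cong: "red x = red y \<Longrightarrow> weight x = weight y"
  unfolding weight_def by simp

text \<open>A nonzero entry is carried along the common part of the two walks; where the walks part, it
  survives only if the row walk is the upper one.\<close>
lemma transport_right:
  assumes T: "\<And>x y. transports F x y" and "u x = u y" "F (red x) (red y) \<noteq> 0"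
    and neq: "\<exists>m. u (x + int m) \<noteq> u (y + int m)"
  shows "\<exists>i\<ge>1. (\<forall>m. 0 \<le> m \<and> m < i \<longrightarrow> u (x + m) = u (y + m)) \<and> u (y + i) < u (x + i)"
proof -
  define n where "n = (LEAST m. u (x + int m) \<noteq> u (y + int m))"
  have n: "u (x + int n) \<noteq> u (y + int n)" unfolding n_def using LeastI_ex[OF neq] .
  have less: "u (x + int m) = u (y + int m)" if "m < n" for m
    using not_less_Least that unfolding n_def by blast
  have n0: "n > 0" using n assms(2) by (cases n) auto
  have nz: "F (red (x + int m)) (red (y + int m)) \<noteq> 0" if "m < n" for m
    using that
  proof (induction m)
    case (Suc m)
    let ?x = "x + int m" and ?y = "y + int m"
    have "u ?x = u ?y" "u (?x + 1) = u (?y + 1)"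
      using less[of m] less[of "Suc m"] Suc.prems by (auto simp: algebra_simps)
    moreover have "F (red ?x) (red ?y) \<noteq> 0" using Suc by simp
    ultimately have "F (red (?x + 1)) (red (?y + 1)) \<noteq> 0"
      using T[of ?x ?y] u_step[of ?x] u_step[of ?y] weight_nonzero unfolding transports_def by auto
    then show ?case by (simp add: algebra_simps)
  qed (use assms in simp)
  let ?x = "x + int (n - 1)" and ?y = "y + int (n - 1)"
  have "\<not> u (?x + 1) < u (?y + 1)"
    using T[of ?x ?y] less[of "n - 1"] nz[of "n - 1"] n0 unfolding transports_def by auto
  then have "u (y + int n) < u (x + int n)"
    using n n0 by (cases n) (auto simp: algebra_simps)
  moreover have "u (x + m) = u (y + m)" if "0 \<le> m" "m < int n" for m
    using less[of "nat m"] that by auto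
  ultimately show ?thesis using n0 by (intro exI[of _ "int n"]) auto
qed

lemma transport_left:
  assumes T: "\<And>x y. transports F x y" and "u x = u y" "F (red x) (red y) \<noteq> 0"
    and neq: "\<exists>m. u (x - int m) \<noteq> u (y - int m)"
  shows "\<exists>i\<ge>1. (\<forall>m. 0 \<le> m \<and> m < i \<longrightarrow> u (x - m) = u (y - m)) \<and> u (y - i) < u (x - i)"
proof -
  define n where "n = (LEAST m. u (x - int m) \<noteq> u (y - int m))"
  have n: "u (x - int n) \<noteq> u (y - int n)" unfolding n_def using LeastI_ex[OF neq] .
  have less: "u (x - int m) = u (y - int m)" if "m < n" for m
    using not_less_Least that unfolding n_def by blast
  have n0: "n > 0" using n assms(2) by (cases n) auto
  have nz: "F (red (x - int m)) (red (y - int m)) \<noteq> 0" if "m < n" for m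
    using that
  proof (induction m)
    case (Suc m)
    let ?x = "x - int (Suc m)" and ?y = "y - int (Suc m)"
    have s: "?x + 1 = x - int m" "?y + 1 = y - int m" by auto
    have "u ?x = u ?y" "u (?x + 1) = u (?y + 1)"
      unfolding s using less[of m] less[of "Suc m"] Suc.prems by auto
    moreover have "F (red (?x + 1)) (red (?y + 1)) \<noteq> 0" unfolding s using Suc by simp
    ultimately show "F (red ?x) (red ?y) \<noteq> 0"
      using T[of ?x ?y] u_step[of ?x] u_step[of ?y] weight_nonzero unfolding transports_def by auto
  qed (use assms in simp)
  let ?x = "x - int n" and ?y = "y - int n"
  have s: "?x + 1 = x - int (n - 1)" "?y + 1 = y - int (n - 1)" using n0 by auto
  have "\<not> u ?x < u ?y"
    using T[of ?x ?y] less[of "n - 1"] nz[of "n - 1"] n0 unfolding transports_def s by auto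
  then have "u (y - int n) < u (x - int n)" using n by simp
  moreover have "u (x - m) = u (y - m)" if "0 \<le> m" "m < int n" for m
    using less[of "nat m"] that by auto
  ultimately show ?thesis using n0 by (intro exI[of _ "int n"]) auto
qed

text \<open>Different residues give different translates, which part on both sides by
  \<open>aperiodic\<close>. A nonzero entry forces the row walk to be the upper one at both ends,
  which is a pinch with the column walk as the lower one.\<close>

lemma transports_off_diagonal:
  assumes prim: "primitive_word w" and np: "\<not> pinch u" and T: "\<And>x y. transports F x y"
    and xy: "u x = u y" "red x \<noteq> red y"
  shows "F (red x) (red y) = 0"
proof (rule ccontr)
  assume nz: "F (red x) (red y) \<noteq> 0"
  have d: "\<not> int L dvd y - x" using xy(2) red_eq_iff[of y x] by auto
  have shift: "u (z + (y - x) - m * int L) = u (z + (y - x))" "u (z - m * int L) = u z" for z m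
    using height_periodic[of "z + (y - x)" "- m"] height_periodic[of z "- m"] by auto
  obtain z where z: "z \<ge> x" "u (z + (y - x)) \<noteq> u z" using aperiodic[OF prim d] by blast
  have "\<exists>m. u (x + int m) \<noteq> u (y + int m)"
    by (rule exI[of _ "nat (z - x)"]) (use z in \<open>auto simp: algebra_simps\<close>)
  from transport_right[OF T xy(1) nz this] obtain i where
    i: "i \<ge> 1" "u (y + i) < u (x + i)" "\<And>m. 0 \<le> m \<Longrightarrow> m < i \<Longrightarrow> u (x + m) = u (y + m)" by blast
  \<comment> \<open>\<open>aperiodic\<close> finds a difference to the right of \<open>x\<close>;
    going back \<open>z - x\<close> whole periods brings it to the left.\<close>
  let ?z = "z - (z - x) * int L"
  have "(z - x) * 1 \<le> (z - x) * int L" using z(1) L_pos by (intro mult_left_mono) linarith+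
  then have "?z \<le> x" by simp
  moreover have "u (?z + (y - x)) \<noteq> u ?z"
    using shift(1)[of z "z - x"] shift(2)[of z "z - x"] z(2) by (simp add: algebra_simps)
  ultimately have "\<exists>m. u (x - int m) \<noteq> u (y - int m)"
    by (intro exI[of _ "nat (x - ?z)"]) (auto simp: algebra_simps)
  from transport_left[OF T xy(1) nz this] obtain j where
    j: "j \<ge> 1" "u (y - j) < u (x - j)" "\<And>m. 0 \<le> m \<Longrightarrow> m < j \<Longrightarrow> u (x - m) = u (y - m)" by blast
  have "u (y - j + m) = u (x - j + m)" if "1 \<le> m" "m \<le> i + j - 1" for m
  proof (cases "m < j")
    case True
    then show ?thesis using j(3)[of "j - m"] that by (simp add: algebra_simps)
  next
    case False
    then show ?thesis using i(3)[of "m - j"] that by (simp add: algebra_simps)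
  qed
  then have "pinch u"
    unfolding pinch_def
    by (intro exI[of _ "y - j"] exI[of _ "x - j"] exI[of _ "i + j - 1"]) (use i j in auto)
  then show False using np by blast
qed

text \<open>On the diagonal both steps have the same weight, which cancels.\<close>

lemma transports_diagonal:
  assumes T: "\<And>x y. transports F x y"
  shows "F (red x) (red x) = F (red 0) (red 0)"
proof -
  have step: "F (red (x + 1)) (red (x + 1)) = F (red x) (red x)" for x
    using T[of x x] u_step[of x] weight_nonzero[of x] unfolding transports_def by auto
  show ?thesis
  proof (induction x rule: int_induct[where k = 0])
    case (step2 i)
    then show ?case using step[of "i - 1"] by simp
  qed (use step in simp_all)
qed

section \<open>Comparison with the scalar endomorphisms\<close>

lemma scalar_endo_index_endo: "scalar_endo Q M c = index_endo (\<lambda>t s. if t = s then c else 0)"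
  unfolding scalar_endo_def index_endo_def band_module_rep_dim
  by (simp add: one_mat_index_mat distinct_positions)

lemma index_endo_eq_iff:
  "index_endo F = index_endo G \<longleftrightarrow> (\<forall>x y. u x = u y \<longrightarrow> F (red x) (red y) = G (red x) (red y))"
proof -
  have "index_endo F = index_endo G \<longleftrightarrow>
      (\<forall>v\<in>verts Q. index_mat (pos N v) (pos N v) F = index_mat (pos N v) (pos N v) G)"
    unfolding index_endo_def restrict_def fun_eq_iff[of "\<lambda>x. if _ x then _ x else _"] by auto
  also have "\<dots> \<longleftrightarrow>
      (\<forall>v\<in>verts Q. \<forall>x. u x = int v \<longrightarrow> (\<forall>y. u y = int v \<longrightarrow> F (red x) (red y) = G (red x) (red y)))"
    unfolding index_mat_eq_iff positions_all_iff ..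
  also have "\<dots> \<longleftrightarrow> (\<forall>x y. u x = u y \<longrightarrow> F (red x) (red y) = G (red x) (red y))"
  proof (intro iffI allI impI ballI)
    fix x y
    assume "\<forall>v\<in>verts Q. \<forall>x. u x = int v \<longrightarrow> (\<forall>y. u y = int v \<longrightarrow> F (red x) (red y) = G (red x) (red y))"
      and "u x = u y"
    moreover have "nat (u x) \<in> verts Q" "u x = int (nat (u x))"
      using height_range[of x] by (simp_all add: Lambda_quiver_def nat_le_iff le_nat_iff)
    ultimately show "F (red x) (red y) = G (red x) (red y)" by metis
  qed auto
  finally show ?thesis .
qed

lemma endomorphism_scalar:
  assumes "primitive_word w" "\<not> pinch u" and f: "f \<in> endomorphisms Q M"
  shows "\<exists>c. f = scalar_endo Q M c"
proof -
  obtain F where F: "f = index_endo F" using endomorphism_index_endo[OF f] by blast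
  then have T: "transports F x y" for x y using f index_endo_iff by blast
  have "f = scalar_endo Q M (F (red 0) (red 0))"
    unfolding F scalar_endo_index_endo index_endo_eq_iff
    using transports_diagonal[OF T] transports_off_diagonal[OF assms(1,2) T] by metis
  then show ?thesis ..
qed

text \<open>The support of the endomorphism of a pinch is the stretch shared by the two walks; the values
  are propagated from its left end.\<close>
lemma pinch_endomorphism:
  assumes "pinch u"
  shows "\<exists>f\<in>endomorphisms Q M. \<forall>c. f \<noteq> scalar_endo Q M c"
proof -
  obtain s t r where r: "1 \<le> r" and st: "u s < u t" "u (s + r + 1) < u (t + r + 1)"
    and eq: "\<And>i. 1 \<le> i \<Longrightarrow> i \<le> r \<Longrightarrow> u (s + i) = u (t + i)"
    using assms unfolding pinch_def by blast
  \<comment> \<open>A longer stretch would contain the point one period after its left end, where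
    the walks differ as they do at \<open>s\<close> and \<open>t\<close>. Hence the points of the
    stretch have distinct residues.\<close>
  have rL: "r < int L"
  proof (rule ccontr)
    assume "\<not> ?thesis"
    then show False using eq[of "int L"] height_periodic[of s 1] height_periodic[of t 1] st L_pos by auto
  qed
  \<comment> \<open>The factor from place \<open>m\<close> of the stretch to the next, obtained by
    solving the first or second equation of \<open>transports\<close> for the new entry; the upper
    walk \<open>t\<close> indexes rows, the lower walk \<open>s\<close> columns.\<close>
  define ratio where "ratio m = (if u (s + m + 1) < u (s + m) then weight (t + m) / weight (s + m)
    else weight (s + m) / weight (t + m))" for m
  define val where "val n = (\<Prod>m\<in>{1..<n}. ratio m)" for n
  have val_step: "val (n + 1) = val n * ratio n" if "1 \<le> n" for n
  proof -
    have "{1..<n + 1} = insert n {1..<n}" using that by auto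
    then show ?thesis unfolding val_def by (simp add: mult.commute)
  qed
  \<comment> \<open>The unique place between 1 and \<open>L\<close> at which the lower walk has
    residue \<open>y\<close>.\<close>
  define idx where "idx y = (int y - s - 1) mod int L + 1" for y
  define F where "F x y = (if idx y \<le> r \<and> x = red (t + idx y) then val (idx y) else 0)" for x y
  define supp where "supp x y i \<longleftrightarrow> 1 \<le> i \<and> i \<le> r \<and> red x = red (t + i) \<and> red y = red (s + i)" for x y i
  have idx: "idx (red y) = i" if "1 \<le> i" "i \<le> r" "red y = red (s + i)" for i y
  proof -
    have "(int (red (s + i)) - s - 1) mod int L = (s + i - s - 1) mod int L"
      unfolding int_red by (simp add: mod_diff_left_eq diff_diff_eq)
    then show ?thesis unfolding idx_def that(3) using that rL by simp
  qed
  have val: "F (red x) (red y) = val i" if "supp x y i" for x y i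
    using that idx[of i y] unfolding supp_def F_def by simp
  have supp: "supp x y (idx (red y))" if "F (red x) (red y) \<noteq> 0" for x y
  proof -
    have i: "idx (red y) \<le> r" "red x = red (t + idx (red y))"
      using that unfolding F_def by (auto split: if_splits)
    have "1 \<le> idx (red y)" unfolding idx_def using L_pos by simp
    moreover have "red (s + idx (red y)) = red y"
    proof -
      have "(s + idx (red y)) mod int L = (s + 1 + (int (red y) - s - 1)) mod int L"
        unfolding idx_def by (metis add.assoc add.commute mod_add_right_eq)
      then show ?thesis unfolding red_def by simp
    qed
    ultimately show ?thesis using i unfolding supp_def by simp
  qed
  have next_supp: "supp (x + 1) (y + 1) (i + 1)" if "supp x y i" "u (x + 1) = u (y + 1)" for x y i
  proof -
    have "red x = red (t + i)" "red y = red (s + i)" using that unfolding supp_def by auto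
    then have "red (x + 1) = red (t + (i + 1))" "red (y + 1) = red (s + (i + 1))"
      using red_shift[of x "t + i" 1] red_shift[of y "s + i" 1] by (simp_all add: add.assoc)
    moreover have "i \<noteq> r"
      using that(2) st(2) red_height_eq[OF calculation(1)] red_height_eq[OF calculation(2)] by (auto simp: add.assoc)
    ultimately show ?thesis using that unfolding supp_def by auto
  qed
  have prev_supp: "supp x y (i - 1)" if "supp (x + 1) (y + 1) i" "u x = u y" for x y i
  proof -
    have "red (x + 1) = red (t + i)" "red (y + 1) = red (s + i)" using that unfolding supp_def by auto
    then have "red x = red (t + (i - 1))" "red y = red (s + (i - 1))"
      using red_shift[of "x + 1" "t + i" "-1"] red_shift[of "y + 1" "s + i" "-1"] by (simp_all add: add_diff_eq)
    moreover have "i \<noteq> 1"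
      using that(2) st(1) red_height_eq[OF calculation(1)] red_height_eq[OF calculation(2)] by auto
    ultimately show ?thesis using that unfolding supp_def by auto
  qed
  have step: "F (red (x + 1)) (red (y + 1)) = F (red x) (red y) *
      (if u (y + 1) < u y then weight x / weight y else weight y / weight x)"
    if "u x = u y" "u (x + 1) = u (y + 1)" for x y
  proof (cases "F (red x) (red y) = 0")
    case True
    \<comment> \<open>Going back along a common step does not leave the stretch, and all values on
      the stretch are products of nonzero factors.\<close>
    have "F (red (x + 1)) (red (y + 1)) = 0"
    proof (rule ccontr)
      assume "\<not> ?thesis"
      note s = prev_supp[OF supp[OF this] that(1)]
      have "val (idx (red (y + 1)) - 1) \<noteq> 0"
        unfolding val_def ratio_def using weight_nonzero by (simp add: prod_zero_iff)
      then show False using val[OF s] True by simp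
    qed
    then show ?thesis using True by simp
  next
    case False
    let ?i = "idx (red y)"
    have i: "supp x y ?i" using supp[OF False] .
    then have c: "red x = red (t + ?i)" "red y = red (s + ?i)" "1 \<le> ?i" unfolding supp_def by auto
    have "F (red (x + 1)) (red (y + 1)) = val ?i * ratio ?i"
      using val[OF next_supp[OF i that(2)]] val_step[OF c(3)] by simp
    moreover have "ratio ?i = (if u (y + 1) < u y then weight x / weight y else weight y / weight x)"
      unfolding ratio_def using weight_cong[OF c(1)] weight_cong[OF c(2)]
        red_height_eq[OF c(2)] red_height_cong[OF c(2), of 1] by simp
    ultimately show ?thesis using val[OF i] by simp
  qed
  have out_right: "F (red x) (red y) = 0" if "u x = u y" "u (x + 1) < u (y + 1)" for x y
  proof (rule ccontr)
    assume "\<not> ?thesis"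
    from supp[OF this] obtain i where i: "1 \<le> i" "i \<le> r" "red x = red (t + i)" "red y = red (s + i)"
      unfolding supp_def by blast
    have "u (t + i + 1) < u (s + i + 1)"
      using that(2) red_height_cong[OF i(3), of 1] red_height_cong[OF i(4), of 1] by simp
    then show False using eq[of "i + 1"] st(2) i by (cases "i = r") (auto simp: add.assoc)
  qed
  have out_left: "F (red (x + 1)) (red (y + 1)) = 0" if "u (x + 1) = u (y + 1)" "u x < u y" for x y
  proof (rule ccontr)
    assume "\<not> ?thesis"
    from supp[OF this] obtain i where i: "1 \<le> i" "i \<le> r" "red (x + 1) = red (t + i)" "red (y + 1) = red (s + i)"
      unfolding supp_def by blast
    have "u x = u (t + (i - 1))" "u y = u (s + (i - 1))"
      using red_height_cong[OF i(3), of "-1"] red_height_cong[OF i(4), of "-1"]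
      by (simp_all add: add_diff_eq)
    then show False using eq[of "i - 1"] st(1) that(2) i(1,2) by (cases "i = 1") simp_all
  qed
  have "transports F x y" for x y
    unfolding transports_def using step[of x y] out_right[of x y] out_left[of x y] weight_nonzero
    by auto
  then have endo: "index_endo F \<in> endomorphisms Q M" using index_endo_iff by blast
  \<comment> \<open>The predecessors \<open>t\<close> and \<open>s\<close> have different heights,
    so the nonzero entry at the start of the stretch is off the diagonal.\<close>
  have neq: "red (t + 1) \<noteq> red (s + 1)"
    using red_height_cong[of "t + 1" "s + 1" "-1"] st(1) by auto
  have "supp (t + 1) (s + 1) 1" using r unfolding supp_def by simp
  then have "F (red (t + 1)) (red (s + 1)) \<noteq> 0" using val by (simp add: val_def)
  then have "index_endo F \<noteq> scalar_endo Q M c" for c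
    unfolding scalar_endo_index_endo index_endo_eq_iff not_all
    by (intro exI[of _ "t + 1"] exI[of _ "s + 1"]) (use neq eq[of 1] r in simp)
  then show ?thesis using endo by blast
qed

theorem weakly_perfectly_clustering_iff_brick:
  assumes "primitive_word w"
  shows "weakly_perfectly_clustering w \<longleftrightarrow> brick Q (Lambda_relations N) M"
proof -
  let ?v = "nat (u 0)"
  have "?v \<in> verts Q" using height_range[of 0] by (simp add: Lambda_quiver_def nat_le_iff le_nat_iff)
  moreover have "red 0 \<in> set (pos N ?v)" using height_range[of 0] by (simp add: red_in_positions)
  then have "rep_dim M ?v > 0" unfolding band_module_rep_dim by (metis length_pos_if_in_set)
  ultimately have "brick Q (Lambda_relations N) M \<longleftrightarrow> (\<forall>f\<in>endomorphisms Q M. \<exists>c. f = scalar_endo Q M c)"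
    by (intro brick_iff is_module_band arcs_ends)
  then show ?thesis
    unfolding weakly_perfectly_clustering_iff
    using endomorphism_scalar[OF assms] pinch_endomorphism by blast
qed

end

theorem theoremB:
  fixes N p :: nat and w :: "nat list"
  assumes "N \<ge> 2"
    and "crown {1..N} w"
    and "primitive_word w"
    and "p < length (phi_tilde w)"
  shows
    "(weakly_perfectly_clustering w \<longleftrightarrow>
       (\<exists>lam :: 'k :: alg_closed_field. lam \<noteq> 0 \<and>
          brick (Lambda_quiver N) (Lambda_relations N)
            (band_module (Lambda_quiver N) (phi_tilde w) p 1 lam))) \<and>
     (weakly_perfectly_clustering w \<longleftrightarrow>
       (\<forall>lam :: 'k. lam \<noteq> 0 \<longrightarrow>
          brick (Lambda_quiver N) (Lambda_relations N)
            (band_module (Lambda_quiver N) (phi_tilde w) p 1 lam)))"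
proof -
  have "weakly_perfectly_clustering w \<longleftrightarrow> brick (Lambda_quiver N) (Lambda_relations N)
      (band_module (Lambda_quiver N) (phi_tilde w) p 1 lam)" if "lam \<noteq> 0" for lam :: 'k
  proof -
    interpret crown_band N w p lam using assms(2) that by unfold_locales
    show ?thesis using weakly_perfectly_clustering_iff_brick assms(3) .
  qed
  \<comment> \<open>The criterion holds for each nonzero \<open>lam\<close> separately, and 1 is
    such a scalar, so existence and universality both reduce to it.\<close>
  then show ?thesis using one_neq_zero by blast
qed

end
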